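(* Let $l$ and $m$ be integers with $l>m\ge 0$. Then $$\log \operatorname{lcm}_{mn<i\le ln}\{i\}\sim Bn$$ as $n\to\infty$ through the positive integers, where $$B=\begin{cases} l, & \text{if } l\ge 2m,\\[1mm] \displaystyle\frac{l}{\left\lfloor\frac{l}{l-m}\right\rfloor}+(l-m)\sum_{i=1}^{\left\lfloor\frac{m}{l-m}\right\rfloor}\frac{1}{i}, & \text{if } m<l<2m.\end{cases}$$
   Context: For a positive integer $n$, $\operatorname{lcm}_{mn<i\le ln}\{i\}$ denotes the least common multiple of all integers $i$ with $mn<i\le ln$. $\lfloor x\rfloor$ is the largest integer not exceeding $x$. $f(n)\sim g(n)$ means $f(n)/g(n)\to 1$. *)

theory Defs
  imports "HOL-Library.Landau_Symbols"
begin

unbundle asymp_equiv_syntax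

(* Meaningful for l > m \<ge> 0 only; under l > m the second branch is the case m < l < 2 m. *)
definition lcm_growth_const :: "int \<Rightarrow> int \<Rightarrow> real" where
  "lcm_growth_const l m =
     (if l \<ge> 2 * m then real_of_int l
      else real_of_int l / real_of_int \<lfloor>real_of_int l / real_of_int (l - m)\<rfloor>
           + real_of_int (l - m) *
             (\<Sum>i = 1..\<lfloor>real_of_int m / real_of_int (l - m)\<rfloor>. 1 / real_of_int i))"

end

theory Submission
  imports Defs "HOL-Complex_Analysis.Complex_Analysis" "HOL-Number_Theory.Number_Theory"
    "HOL-Real_Asymp.Real_Asymp"
begin

text \<open>
  Write \<psi>(N) for the sum of the von Mangoldt function \<Lambda>(d) over d \<le> N. For a finite set A of positive
  integers, ln (Lcm A) is the sum of \<Lambda>(d) over all d that divide some element of A: a prime power divides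
  the lcm exactly if it divides one of the elements, and all other d have \<Lambda>(d) = 0. A number d has a
  multiple in the interval (mn, ln] exactly if mn/k < d \<le> ln/k for some k \<ge> 1. With K = \<lfloor>m/(l-m)\<rfloor>,
  the intervals (mn/k, ln/k] are pairwise disjoint for k \<le> K, while those with k > K together cover
  (0, ln/(K+1)] (lemma \<open>divisors_of_interval\<close>). Hence ln (Lcm (mn, ln]) is the sum of
  \<psi>(ln/k) - \<psi>(mn/k) over k \<le> K, plus \<psi>(ln/(K+1)), and the constant B can be read off as soon
  as \<psi>(N) is known to be asymptotic to N. That is the prime number theorem, and proving it is most of
  the work.

  The prime number theorem is derived along Newman's lines. The Tauberian theorem
  \<open>newman_tauberian\<close> says that a Dirichlet series with bounded coefficients converges at s = 1 if its sum
  extends holomorphically across the line Re s = 1. It is applied to the coefficients \<psi>(n)/n - 1, which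
  are bounded by Chebyshev's estimate (\<open>psi_le\<close>). Their Dirichlet series is, up to a function
  holomorphic on Re s > 0, equal to (-\<zeta>'(s)/\<zeta>(s) - \<zeta>(s))/s. The poles of -\<zeta>'/\<zeta> and of \<zeta> at 1 cancel,
  and \<zeta> has no zeros on Re s \<ge> 1 (\<open>zeta_reg_nonzero\<close>), so the theorem applies. The resulting
  convergence of the sum of (\<psi>(n) - n)/n^2 forces \<psi>(n)/n to tend to 1 because \<psi> is
  monotone (\<open>incseq_tendsto_1_of_summable\<close>).

  All Dirichlet series are summed over all natural numbers including 0. The term n = 0 vanishes because
  0 powr z = 0.
\<close>

section \<open>Dirichlet series with holomorphic sum\<close>

lemma norm_of_nat_powr: "n > 0 \<Longrightarrow> norm (of_nat n powr s :: complex) = real n powr Re s"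
  by (subst norm_powr_real_powr) auto

lemma norm_powr_diff_le:
  assumes "0 < a" "a \<le> b" "Re z \<le> 1"
  shows "norm (of_real b powr z - of_real a powr z :: complex) \<le> norm z * a powr (Re z - 1) * (b - a)"
proof -
  have "norm (of_real b powr z - of_real a powr z :: complex) 
          \<le> (norm z * a powr (Re z - 1)) * norm (of_real b - of_real a :: complex)"
  proof (rule field_differentiable_bound[where S = "closed_segment (of_real a) (of_real b)"])
    fix w :: complex assume "w \<in> closed_segment (of_real a) (of_real b)"
    then obtain x where x: "w = of_real x" "a \<le> x" "x \<le> b"
      using assms by (auto simp: closed_segment_of_real closed_segment_eq_real_ivl)
    show "((\<lambda>w. w powr z) has_field_derivative (z * w powr (z - 1))) (at w within closed_segment (of_real a) (of_real b))"
      using x assms by (intro has_field_derivative_at_within[OF has_field_derivative_powr]) auto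
    have "x powr (Re z - 1) \<le> a powr (Re z - 1)"
      using x assms by (intro powr_mono2') auto
    then show "norm (z * w powr (z - 1)) \<le> norm z * a powr (Re z - 1)"
      using x assms by (simp add: norm_mult norm_powr_real_powr mult_left_mono)
  qed auto
  also have "norm (of_real b - of_real a :: complex) = b - a"
    using assms by (metis abs_of_nonneg diff_ge_0_iff_ge norm_of_real of_real_diff)
  finally show ?thesis .
qed

text \<open>
  For Re s > 1, summing over n makes the first two parts telescope to 0, and the third gives (s - 1) \<zeta>(s). So
  this is the n-th term of a series for (s - 1) \<zeta>(s), which has no pole at s = 1. For n > 0 the term is the error of
  the first-order Taylor expansion of x powr (1 - s) at n, taken at n + 1. It is one power of n smaller than the linear
  part, so the series converges for Re s > 0.
\<close>
definition zeta_term :: "nat \<Rightarrow> complex \<Rightarrow> complex" where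
  "zeta_term n s = of_nat (Suc n) powr (1 - s) - of_nat n powr (1 - s) - (1 - s) * of_nat n powr (- s)"

text \<open>
  The mean value inequality is used twice: once for x powr (1 - s) minus its linear part at n, whose
  derivative is (1 - s) times the increment of x powr (- s), and once for that increment.
\<close>
lemma norm_zeta_term_le:
  assumes "n > 0" "Re s > 0"
  shows "norm (zeta_term n s) \<le> norm s * norm (s - 1) * real n powr (- Re s - 1)"
proof -
  define f where "f = (\<lambda>w::complex. w powr (1 - s) - (1 - s) * of_nat n powr (- s) * w)"
  have "norm (f (of_nat (Suc n)) - f (of_nat n))
          \<le> (norm (s - 1) * (norm s * real n powr (- Re s - 1))) * norm (of_nat (Suc n) - of_nat n :: complex)"
  proof (rule field_differentiable_bound[where S = "closed_segment (of_real n) (of_real (n + 1))"])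
    fix w :: complex assume "w \<in> closed_segment (of_real n) (of_real (n + 1))"
    then obtain x where x: "w = of_real x" "real n \<le> x" "x \<le> real n + 1"
      using assms closed_segment_of_real[of "real n" "real (n + 1)", where ?'a = complex] 
      by (auto simp: closed_segment_eq_real_ivl)
    show "(f has_field_derivative ((1 - s) * (w powr (- s) - of_nat n powr (- s)))) 
            (at w within closed_segment (of_real n) (of_real (n + 1)))"
      unfolding f_def
      by (rule derivative_eq_intros refl | use x assms in \<open>simp add: algebra_simps\<close>)+
    have "norm (of_real x powr (-s) - of_real (real n) powr (-s) :: complex) 
            \<le> norm (-s) * real n powr (Re (-s) - 1) * (x - real n)"
      by (rule norm_powr_diff_le) (use x assms in auto)
    also have "\<dots> \<le> norm (-s) * real n powr (Re (-s) - 1) * 1"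
      using x by (intro mult_left_mono) auto
    finally show "norm ((1 - s) * (w powr (- s) - of_nat n powr (- s)))
                    \<le> norm (s - 1) * (norm s * real n powr (- Re s - 1))"
      using x by (simp add: norm_mult norm_minus_commute mult_left_mono)
  qed auto
  also have "f (of_nat (Suc n)) - f (of_nat n) = zeta_term n s"
    by (simp add: f_def zeta_term_def algebra_simps)
  finally show ?thesis by (simp add: mult_ac)
qed

lemma summable_nat_powr: "x < -1 \<Longrightarrow> summable (\<lambda>n. real n powr x)"
  by (simp add: summable_real_powr_iff)

text \<open>
  Absolute convergence for every real exponent above 1 makes the series locally uniformly convergent on
  Re s > 1, so it may be differentiated termwise.
\<close>
lemma dirichlet_series_deriv:
  fixes a :: "nat \<Rightarrow> complex"
  assumes "\<And>x. x > 1 \<Longrightarrow> summable (\<lambda>n. norm (a n) * real n powr (-x))"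
  obtains g g' where
    "\<And>s. Re s > 1 \<Longrightarrow> (\<lambda>n. a n * of_nat n powr (- s)) sums g s"
    "\<And>s. Re s > 1 \<Longrightarrow> (\<lambda>n. - of_real (ln (real n)) * a n * of_nat n powr (- s)) sums g' s"
    "\<And>s. Re s > 1 \<Longrightarrow> (g has_field_derivative g' s) (at s)"
proof -
  have "\<exists>g g'. \<forall>s\<in>{s. Re s > 1}. (\<lambda>n. a n * of_nat n powr (- s)) sums g s \<and>
      (\<lambda>n. - of_real (ln (real n)) * a n * of_nat n powr (- s)) sums g' s \<and>
      (g has_field_derivative g' s) (at s)"
  proof (rule series_and_derivative_comparison_complex)
    show "open {s. Re s > 1}" by (simp add: open_halfspace_Re_gt)
    show "((\<lambda>s. a n * of_nat n powr (- s)) has_field_derivative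
            - of_real (ln (real n)) * a n * of_nat n powr (- s)) (at s)" for n s
    proof (cases "n = 0")
      case False
      then show ?thesis
        by (auto intro!: derivative_eq_intros has_field_derivative_powr_right[THEN DERIV_chain2] 
                 simp: algebra_simps)
    qed auto
    fix s assume s: "s \<in> {s. Re s > 1}"
    define d where "d = (Re s - 1) / 2"
    define h where "h = (\<lambda>n. complex_of_real (norm (a n) * real n powr (-(1+d))))"
    have "norm (a n * of_nat n powr (- y)) \<le> norm (h n)" if "y \<in> ball s d" for y n
    proof (cases "n = 0")
      case False
      have "\<bar>Re (s - y)\<bar> < d"
        using that abs_Re_le_cmod[of "s - y"] by (auto simp: dist_norm)
      moreover have "Re s = 1 + 2 * d" by (simp add: d_def field_simps)
      ultimately have "Re y \<ge> 1 + d" unfolding minus_complex.sel by linarith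
      then have "real n powr (- Re y) \<le> real n powr (-(1+d))"
        using False by (intro powr_mono) auto
      then show ?thesis using False
        by (simp add: norm_mult norm_of_nat_powr h_def mult_left_mono del: of_real_mult)
    qed auto
    moreover have "summable h"
      unfolding h_def using s by (intro summable_of_real assms) (auto simp: d_def)
    moreover have "d > 0" using s by (auto simp: d_def)
    moreover have "range h \<subseteq> \<real>\<^sub>\<ge>\<^sub>0" by (auto simp: h_def simp del: of_real_mult)
    ultimately show "\<exists>d (h :: nat \<Rightarrow> complex). 0 < d \<and> summable h \<and> range h \<subseteq> \<real>\<^sub>\<ge>\<^sub>0 \<and> 
       (\<forall>\<^sub>F n in sequentially. \<forall>y\<in>ball s d \<inter> {s. Re s > 1}. norm (a n * of_nat n powr (- y)) \<le> norm (h n))"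
      by (intro exI[of _ d] exI[of _ h] conjI always_eventually) auto
  qed
  then obtain g g' where "\<forall>s\<in>{s. Re s > 1}. (\<lambda>n. a n * of_nat n powr (- s)) sums g s \<and>
      (\<lambda>n. - of_real (ln (real n)) * a n * of_nat n powr (- s)) sums g' s \<and>
      (g has_field_derivative g' s) (at s)" by blast
  then show ?thesis using that[of g g'] by blast
qed

text \<open>
  The weights c n are needed in two cases: the weights 1 for n > 0 give the continuation of \<zeta> to Re s > 0, and the
  weights \<psi>(n) - n = O(n) compare two forms of the Dirichlet series to which Newman's theorem is applied.
\<close>
lemma zeta_term_series_holomorphic:
  fixes c :: "nat \<Rightarrow> complex"
  assumes c: "\<And>n. norm (c n) \<le> B * real n powr r" "r \<ge> 0"
  obtains Z where "Z holomorphic_on {s. Re s > r}" 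
     "\<And>s. Re s > r \<Longrightarrow> (\<lambda>n. c n * zeta_term n s) sums Z s"
proof -
  have B: "B \<ge> 0" using c(1)[of 1] norm_ge_zero[of "c 1"] by (simp del: norm_ge_zero)
  have "\<exists>g g'. \<forall>s\<in>{s. Re s > r}. (\<lambda>n. c n * zeta_term n s) sums g s \<and>
      (\<lambda>n. deriv (\<lambda>s. c n * zeta_term n s) s) sums g' s \<and> (g has_field_derivative g' s) (at s)"
  proof (rule series_and_derivative_comparison_complex)
    show "open {s. Re s > r}" by (simp add: open_halfspace_Re_gt)
    have pd: "(\<lambda>s. w powr f s) field_differentiable (at s)" 
      if "w \<noteq> 0" "f field_differentiable (at s)" for w s :: complex and f
      using field_differentiable_compose[OF that(2) field_differentiable_powr_right[OF that(1)]] 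
      by (simp add: o_def)
    have "(\<lambda>s. c n * zeta_term n s) field_differentiable (at s)" for n s
      unfolding zeta_term_def 
      by (cases "n = 0") (auto intro!: derivative_intros pd simp del: of_nat_Suc)
    then show "((\<lambda>s. c n * zeta_term n s) has_field_derivative deriv (\<lambda>s. c n * zeta_term n s) s) (at s)" for n s
      by (simp add: field_differentiable_derivI)
    fix s assume s: "s \<in> {s. Re s > r}"
    define d where "d = (Re s - r) / 2"
    define C where "C = (norm s + d) * (norm s + d + 1)"
    have d: "d > 0" using s by (auto simp: d_def)
    define h where "h = (\<lambda>n. complex_of_real (B * C * real n powr (-(1+d))))"
    have "norm (c n * zeta_term n y) \<le> norm (h n)" if "y \<in> ball s d" "n > 0" for y n
    proof -
      have *: "norm (y - s) < d" using that by (auto simp: dist_norm norm_minus_commute)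
      have 1: "norm y \<le> norm s + d" using norm_triangle_sub[of y s] * by simp
      then have 2: "norm (y - 1) \<le> norm s + d + 1" using norm_triangle_ineq4[of y 1] by simp
      have "\<bar>Re (s - y)\<bar> < d"
        using that abs_Re_le_cmod[of "s - y"] by (auto simp: dist_norm)
      moreover have "Re s = r + 2 * d" by (simp add: d_def field_simps)
      ultimately have re: "Re y > r + d" unfolding minus_complex.sel by linarith
      have "norm (zeta_term n y) \<le> norm y * norm (y - 1) * real n powr (- Re y - 1)"
        using that re d c(2) by (intro norm_zeta_term_le) auto
      also have "\<dots> \<le> C * real n powr (-(r+d) - 1)"
        unfolding C_def using that re 1 2 d by (intro mult_mono powr_mono) auto
      finally have "norm (c n * zeta_term n y) \<le> (B * real n powr r) * (C * real n powr (-(r+d) - 1))"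
        unfolding norm_mult using c B by (intro mult_mono) auto
      also have "\<dots> = B * C * (real n powr r * real n powr (-(r+d) - 1))" by (simp add: mult_ac)
      also have "real n powr r * real n powr (-(r+d) - 1) = real n powr (-(1+d))"
        by (simp flip: powr_add add: algebra_simps)
      finally show ?thesis using that by (simp add: h_def del: of_real_mult)
    qed
    then have "\<forall>\<^sub>F n in sequentially. \<forall>y\<in>ball s d \<inter> {s. Re s > r}. norm (c n * zeta_term n y) \<le> norm (h n)"
      by (intro eventually_mono[OF eventually_gt_at_top[of 0]]) auto
    moreover have "summable h"
      unfolding h_def using d by (intro summable_of_real summable_mult summable_nat_powr) auto
    moreover have "range h \<subseteq> \<real>\<^sub>\<ge>\<^sub>0" using B d by (auto simp: h_def C_def simp del: of_real_mult)
    ultimately show "\<exists>d (h :: nat \<Rightarrow> complex). 0 < d \<and> summable h \<and> range h \<subseteq> \<real>\<^sub>\<ge>\<^sub>0 \<and> 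
       (\<forall>\<^sub>F n in sequentially. \<forall>y\<in>ball s d \<inter> {s. Re s > r}. norm (c n * zeta_term n y) \<le> norm (h n))"
      using d by (intro exI[of _ d] exI[of _ h]) auto
  qed
  then obtain g g' where g: "\<forall>s\<in>{s. Re s > r}. (\<lambda>n. c n * zeta_term n s) sums g s \<and>
      (\<lambda>n. deriv (\<lambda>s. c n * zeta_term n s) s) sums g' s \<and> (g has_field_derivative g' s) (at s)" by blast
  show ?thesis
  proof
    show "g holomorphic_on {s. Re s > r}"
      using g by (auto simp: holomorphic_on_open open_halfspace_Re_gt)
    show "(\<lambda>n. c n * zeta_term n s) sums g s" if "Re s > r" for s using g that by blast
  qed
qed

section \<open>The zeta function and its logarithmic derivative\<close>

definition zeta :: "complex \<Rightarrow> complex" where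
  "zeta s = (\<Sum>n. of_nat n powr (- s))"

text \<open>
  This is (s - 1) \<zeta>(s) continued to Re s > 0. Working with it avoids the pole of \<zeta> throughout.
\<close>
definition zeta_reg :: "complex \<Rightarrow> complex" where
  "zeta_reg s = (\<Sum>n. zeta_term n s)"

definition mangoldt_series :: "complex \<Rightarrow> complex" where
  "mangoldt_series s = (\<Sum>n. mangoldt n * of_nat n powr (- s))"

lemma zeta_sums:
  assumes "Re s > 1"
  shows "(\<lambda>n. of_nat n powr (- s)) sums zeta s"
    and "(\<lambda>n. of_real (ln (real n)) * of_nat n powr (- s)) sums (- deriv zeta s)"
    and "zeta field_differentiable (at s)"
proof -
  have "summable (\<lambda>n. norm (1 :: complex) * real n powr (-x))" if "x > 1" for x
    using that by (simp add: summable_nat_powr)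
  then obtain g g' where g: 
    "\<And>s. Re s > 1 \<Longrightarrow> (\<lambda>n. 1 * of_nat n powr (- s)) sums g s"
    "\<And>s. Re s > 1 \<Longrightarrow> (\<lambda>n. - of_real (ln (real n)) * 1 * of_nat n powr (- s)) sums g' s"
    "\<And>s. Re s > 1 \<Longrightarrow> (g has_field_derivative g' s) (at s)"
    using dirichlet_series_deriv[of "\<lambda>_. 1"] by blast
  have eq: "zeta s = g s" if "Re s > 1" for s
    using g(1)[OF that] by (simp add: zeta_def sums_iff)
  have "(zeta has_field_derivative g' s) (at s)"
    by (rule has_field_derivative_transform_within_open[OF g(3)[OF assms], of "{s. Re s > 1}"])
       (use assms eq in \<open>auto simp: open_halfspace_Re_gt\<close>)
  then show "zeta field_differentiable (at s)" "(\<lambda>n. of_real (ln (real n)) * of_nat n powr (- s)) sums (- deriv zeta s)"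
    using sums_minus[OF g(2)[OF assms]] by (auto simp: field_differentiable_def DERIV_imp_deriv)
  show "(\<lambda>n. of_nat n powr (- s)) sums zeta s"
    using g(1)[OF assms] eq[OF assms] by simp
qed

text \<open>
  The logarithm is absorbed by half of the available excess x - 1 of the exponent.
\<close>
lemma summable_ln_powr:
  assumes "x > 1"
  shows "summable (\<lambda>n. ln (real n) * real n powr (- x))"
proof (rule summable_comparison_test)
  define e where "e = (x - 1) / 2"
  have e: "e > 0" "x - e > 1" using assms by (auto simp: e_def field_simps)
  show "summable (\<lambda>n. real n powr (e - x) / e)"
    using e by (intro summable_divide summable_nat_powr) auto
  show "\<exists>N. \<forall>n\<ge>N. norm (ln (real n) * real n powr (- x)) \<le> real n powr (e - x) / e"
  proof (intro exI[of _ 1] allI impI)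
    fix n :: nat assume n: "n \<ge> 1"
    then have "ln (real n) \<le> real n powr e / e" using ln_powr_bound[of "real n" e] e by simp
    then have "ln (real n) * real n powr (- x) \<le> real n powr e / e * real n powr (- x)"
      by (intro mult_right_mono) auto
    also have "\<dots> = real n powr (e - x) / e" by (simp add: powr_diff powr_minus field_simps)
    finally show "norm (ln (real n) * real n powr (- x)) \<le> real n powr (e - x) / e"
      using n by simp
  qed
qed

lemma mangoldt_le_ln: "(mangoldt n :: real) \<le> ln (real n)"
  using mangoldt_le[of n] by (cases "n = 0") auto

lemma mangoldt_summable_powr:
  assumes "x > 1"
  shows "summable (\<lambda>n. mangoldt n * real n powr (- x))"
  by (rule summable_comparison_test'[OF summable_ln_powr[OF assms], of 0]) 
     (auto simp: abs_mult intro!: mult_right_mono mangoldt_le_ln)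

lemma mangoldt_series:
  assumes "Re s > 1"
  shows "(\<lambda>n. mangoldt n * of_nat n powr (- s)) sums mangoldt_series s"
    and "mangoldt_series field_differentiable (at s)"
proof -
  have "summable (\<lambda>n. norm (mangoldt n :: complex) * real n powr (-x))" if "x > 1" for x
    using mangoldt_summable_powr[OF that] by simp
  then obtain g g' where g: 
    "\<And>s. Re s > 1 \<Longrightarrow> (\<lambda>n. mangoldt n * of_nat n powr (- s)) sums g s"
    "\<And>s. Re s > 1 \<Longrightarrow> (\<lambda>n. - of_real (ln (real n)) * mangoldt n * of_nat n powr (- s)) sums g' s"
    "\<And>s. Re s > 1 \<Longrightarrow> (g has_field_derivative g' s) (at s)"
    using dirichlet_series_deriv[of mangoldt] by blast
  have eq: "mangoldt_series s = g s" if "Re s > 1" for s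
    using g(1)[OF that] by (simp add: mangoldt_series_def sums_iff)
  have "(mangoldt_series has_field_derivative g' s) (at s)"
    by (rule has_field_derivative_transform_within_open[OF g(3)[OF assms], of "{s. Re s > 1}"])
       (use assms eq in \<open>auto simp: open_halfspace_Re_gt\<close>)
  then show "mangoldt_series field_differentiable (at s)" by (auto simp: field_differentiable_def)
  show "(\<lambda>n. mangoldt n * of_nat n powr (- s)) sums mangoldt_series s"
    using g(1)[OF assms] eq[OF assms] by simp
qed

lemma zeta_reg_holomorphic: "zeta_reg holomorphic_on {s. Re s > 0}"
  and zeta_reg_sums: "Re s > 0 \<Longrightarrow> (\<lambda>n. zeta_term n s) sums zeta_reg s"
proof -
  \<comment> \<open>The term n = 0 is the constant 1. It is split off because the bound on the weights forces the weight of n = 0 to vanish.\<close>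
  have c: "norm (if n = 0 then 0 else 1 :: complex) \<le> 1 * real n powr 0" for n by auto
  obtain Z where Z: "Z holomorphic_on {s. Re s > 0}"
     "\<And>s. Re s > 0 \<Longrightarrow> (\<lambda>n. (if n = 0 then 0 else 1) * zeta_term n s) sums Z s"
    using zeta_term_series_holomorphic[OF c order_refl] by blast
  have sums: "(\<lambda>n. zeta_term n s) sums (Z s + 1)" if "Re s > 0" for s
  proof -
    have "(\<lambda>n. (if n = 0 then 0 else 1) * zeta_term n s + (if n = 0 then 1 else 0)) sums (Z s + 1)"
      by (rule sums_add[OF Z(2)[OF that]]) (use sums_single[of 0 "\<lambda>_. 1"] in simp)
    also have "(\<lambda>n. (if n = 0 then 0 else 1) * zeta_term n s + (if n = 0 then 1 else 0)) = (\<lambda>n. zeta_term n s)"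
      by (auto simp: zeta_term_def)
    finally show ?thesis .
  qed
  then have eq: "zeta_reg s = Z s + 1" if "Re s > 0" for s
    using that by (simp add: zeta_reg_def sums_iff)
  have "(\<lambda>s. Z s + 1) holomorphic_on {s. Re s > 0}" by (intro holomorphic_intros Z)
  then show "zeta_reg holomorphic_on {s. Re s > 0}"
    by (rule holomorphic_transform) (use eq in auto)
  show "Re s > 0 \<Longrightarrow> (\<lambda>n. zeta_term n s) sums zeta_reg s"
    using sums eq by simp
qed

lemma zeta_reg_1: "zeta_reg 1 = 1"
proof -
  have "zeta_term n 1 = (if n = 0 then 1 else 0)" for n
    by (auto simp: zeta_term_def simp del: of_nat_Suc)
  then have "(\<lambda>n. zeta_term n 1) sums 1" using sums_single[of 0 "\<lambda>_. 1::complex"] by simp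
  then show ?thesis using zeta_reg_sums[of 1] sums_unique2 by auto
qed

lemma zeta_reg_eq:
  assumes "Re s > 1"
  shows "zeta_reg s = (s - 1) * zeta s"
proof -
  have "(\<lambda>n. of_nat n powr (1 - s) :: complex) \<longlonglongrightarrow> 0"
  proof (rule Lim_null_comparison)
    show "\<forall>\<^sub>F n in sequentially. norm (of_nat n powr (1 - s) :: complex) \<le> real n powr (1 - Re s)"
      using eventually_gt_at_top[of 0] by eventually_elim (simp add: norm_of_nat_powr)
    show "(\<lambda>n. real n powr (1 - Re s)) \<longlonglongrightarrow> 0"
      using assms by real_asymp
  qed
  then have "(\<lambda>n. of_nat (Suc n) powr (1 - s) - of_nat n powr (1 - s)) sums (0 - of_nat 0 powr (1 - s))"
    by (rule telescope_sums)
  from sums_diff[OF this sums_mult[OF zeta_sums(1)[OF assms], of "1 - s"]]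
  have "(\<lambda>n. zeta_term n s) sums ((s - 1) * zeta s)"
    by (simp add: zeta_term_def algebra_simps)
  then show ?thesis using zeta_reg_sums[of s] assms sums_unique2 by force
qed

text \<open>
  Multiplying out gives the Dirichlet series whose coefficient at n is the sum of \<Lambda>(d) over d dvd n,
  that is ln n. The double series converges absolutely and may be regrouped along the products n = d e.
\<close>
lemma mangoldt_series_mult_zeta:
  assumes s: "Re s > 1"
  shows "mangoldt_series s * zeta s = - deriv zeta s"
proof -
  define a where "a = (\<lambda>d::nat. mangoldt d * of_nat d powr (- s) :: complex)"
  define b where "b = (\<lambda>d::nat. of_nat d powr (- s) :: complex)"
  have na: "norm (a n) = mangoldt n * real n powr (- Re s)" for n
    by (cases "n = 0") (auto simp: a_def norm_mult norm_of_nat_powr)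
  have nb: "norm (b n) = real n powr (- Re s)" for n
    by (cases "n = 0") (auto simp: b_def norm_mult norm_of_nat_powr)
  have suma: "summable (\<lambda>n. norm (a n))"
    unfolding na by (rule mangoldt_summable_powr[OF s])
  have sumb: "summable (\<lambda>n. norm (b n))"
    unfolding nb using s by (intro summable_nat_powr) auto
  have pos: "(f has_sum c) {0<..}" if "(f has_sum c) UNIV" "f 0 = 0" for f :: "nat \<Rightarrow> complex" and c
    using that(1) by (rule has_sum_cong_neutral[THEN iffD1, rotated -1]) (use that(2) in auto)
  have A: "(a has_sum mangoldt_series s) {0<..}"
    by (intro pos norm_summable_imp_has_sum suma) (use mangoldt_series[OF s] in \<open>auto simp: a_def\<close>)
  have B: "(b has_sum zeta s) {0<..}"
    by (intro pos norm_summable_imp_has_sum sumb) (use zeta_sums[OF s] in \<open>auto simp: b_def\<close>)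
  have suma': "(\<lambda>n. norm (a n)) summable_on {0<..}"
    by (rule summable_on_subset_banach[OF summable_nonneg_imp_summable_on[OF suma]]) auto
  have sumb': "(\<lambda>n. norm (b n)) summable_on {0<..}"
    by (rule summable_on_subset_banach[OF summable_nonneg_imp_summable_on[OF sumb]]) auto
  have "(\<lambda>x. norm (case x of (d, e) \<Rightarrow> a d * b e)) summable_on ({0<..} \<times> {0<..})"
  proof (rule summable_on_SigmaI)
    show "((\<lambda>e. norm (case (d, e) of (d, e) \<Rightarrow> a d * b e)) has_sum (norm (a d) * infsum (\<lambda>n. norm (b n)) {0<..})) {0<..}" for d
      using has_sum_cmult_right[OF has_sum_infsum[OF sumb'], of "norm (a d)"] by (simp add: norm_mult)
    show "(\<lambda>d. norm (a d) * infsum (\<lambda>n. norm (b n)) {0<..}) summable_on {0<..}"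
      by (rule summable_on_cmult_left[OF suma'])
  qed auto
  then have "(\<lambda>x. case x of (d, e) \<Rightarrow> a d * b e) summable_on ({0<..} \<times> {0<..})"
    by (rule abs_summable_summable)
  then have "((\<lambda>x. case x of (d, e) \<Rightarrow> a d * b e) has_sum (mangoldt_series s * zeta s)) ({0<..} \<times> {0<..})"
    using has_sum_cmult_right[OF B] has_sum_cmult_left[OF A]
    by (intro has_sum_SigmaI[where g = "\<lambda>d. a d * zeta s"]) auto
  also have "?this \<longleftrightarrow> ((\<lambda>(n, d). a d * b (n div d)) has_sum (mangoldt_series s * zeta s)) 
                          (Sigma {0<..} (\<lambda>n. {d. d dvd n}))"
    by (rule has_sum_reindex_bij_witness[where j = "\<lambda>(d, e). (d * e, d)" and i = "\<lambda>(n, d). (d, n div d)"])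
       (auto intro!: Nat.gr0I)
  finally have *: "((\<lambda>(n, d). a d * b (n div d)) has_sum (mangoldt_series s * zeta s)) 
                          (Sigma {0<..} (\<lambda>n. {d. d dvd n}))" .
  have "((\<lambda>n. of_real (ln (real n)) * of_nat n powr (- s)) has_sum (mangoldt_series s * zeta s)) {0<..}"
  proof (rule has_sum_SigmaD[OF *])
    fix n :: nat assume n: "n \<in> {0<..}"
    have "(\<Sum>d | d dvd n. a d * b (n div d)) = (\<Sum>d | d dvd n. mangoldt d * of_nat n powr (- s))"
    proof (rule sum.cong)
      fix d assume "d \<in> {d. d dvd n}"
      then obtain e where e: "n = d * e" by auto
      then have "d > 0" using n by (auto intro!: Nat.gr0I)
      then have "(of_nat n :: complex) powr (- s) = of_nat d powr (- s) * of_nat (n div d) powr (- s)"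
        using e by (simp add: powr_times_real)
      then show "a d * b (n div d) = mangoldt d * of_nat n powr (- s)"
        by (simp add: a_def b_def)
    qed auto
    also have "\<dots> = of_real (ln (real n)) * of_nat n powr (- s)"
      using mangoldt_sum[of n, where ?'a = complex] n by (simp flip: sum_distrib_right)
    finally show "((\<lambda>d. case (n, d) of (n, d) \<Rightarrow> a d * b (n div d)) has_sum 
                    of_real (ln (real n)) * of_nat n powr (- s)) {d. d dvd n}"
      using n has_sum_finite[of "{d. d dvd n}" "\<lambda>d. a d * b (n div d)"] by simp
  qed
  moreover have "((\<lambda>n. of_real (ln (real n)) * of_nat n powr (- s)) has_sum (- deriv zeta s)) {0<..}"
  proof (intro pos norm_summable_imp_has_sum zeta_sums s)
    have "norm (of_real (ln (real n)) * of_nat n powr (- s) :: complex) = ln (real n) * real n powr (- Re s)" for n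
      by (cases "n = 0") (auto simp: norm_mult norm_of_nat_powr)
    then show "summable (\<lambda>n. norm (of_real (ln (real n)) * of_nat n powr (- s) :: complex))"
      using summable_ln_powr[OF s] by simp
  qed auto
  ultimately show ?thesis using has_sum_unique by blast
qed

section \<open>Zeta has no zeros on the closed half-plane\<close>

text \<open>
  The number n is the order of the zero of f at s0: writing f = (s - s0)^n g with g nonzero near s0, the
  logarithmic derivative of f is n/(s - s0) + g'/g.
\<close>
lemma log_deriv_tendsto_order:
  assumes f: "f holomorphic_on S" "open S" "connected S" and s0: "s0 \<in> S" and z: "z \<in> S" "f z \<noteq> 0"
  obtains n :: nat where "((\<lambda>s. (s - s0) * deriv f s / f s) \<longlongrightarrow> of_nat n) (at s0)"
    "f s0 = 0 \<longleftrightarrow> n > 0" "eventually (\<lambda>s. f s \<noteq> 0) (at s0)"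
proof (cases "f s0 = 0")
  case False
  have f1: "f \<midarrow>s0\<rightarrow> f s0"
    using f s0 holomorphic_on_imp_continuous_on[of f S] by (simp add: continuous_on_eq_continuous_at isCont_def)
  have f2: "deriv f \<midarrow>s0\<rightarrow> deriv f s0"
    using f s0 holomorphic_on_imp_continuous_on[OF holomorphic_deriv[of f S]] 
    by (simp add: continuous_on_eq_continuous_at isCont_def)
  have "((\<lambda>s. (s - s0) * deriv f s / f s) \<longlongrightarrow> (s0 - s0) * deriv f s0 / f s0) (at s0)"
    by (intro tendsto_intros f1 f2 False)
  moreover have "eventually (\<lambda>s. f s \<noteq> 0) (at s0)"
    using f1 False by (rule tendsto_imp_eventually_ne)
  ultimately show ?thesis using that[of 0] False by simp
next
  case True
  then have nonconst: "\<not> f constant_on S" using z s0 unfolding constant_on_def by metis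
  obtain g r n where g: "0 < n" "0 < r" "ball s0 r \<subseteq> S" "g holomorphic_on ball s0 r"
     "\<And>w. w \<in> ball s0 r \<Longrightarrow> f w = (w - s0) ^ n * g w" "\<And>w. w \<in> ball s0 r \<Longrightarrow> g w \<noteq> 0"
    by (rule holomorphic_factor_zero_nonconstant[OF f s0 True nonconst]) (rule that; assumption)
  have near: "eventually (\<lambda>w. w \<in> ball s0 r - {s0}) (at s0)"
    using g(2) by (intro eventually_at_in_open) auto
  have g1: "g \<midarrow>s0\<rightarrow> g s0"
    using g(2,4) holomorphic_on_imp_continuous_on[of g "ball s0 r"] by (simp add: continuous_on_eq_continuous_at isCont_def)
  have g2: "deriv g \<midarrow>s0\<rightarrow> deriv g s0"
    using g(2,4) holomorphic_on_imp_continuous_on[OF holomorphic_deriv[of g "ball s0 r"]] 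
    by (simp add: continuous_on_eq_continuous_at isCont_def)
  have "((\<lambda>w. of_nat n + (w - s0) * deriv g w / g w) \<longlongrightarrow> of_nat n + (s0 - s0) * deriv g s0 / g s0) (at s0)"
    by (intro tendsto_intros g1 g2 g(6)) (use g(2) in auto)
  moreover have "eventually (\<lambda>w. of_nat n + (w - s0) * deriv g w / g w = (w - s0) * deriv f w / f w) (at s0)"
    using near
  proof eventually_elim
    case (elim w)
    have "(g has_field_derivative deriv g w) (at w)"
      using elim g(4) by (intro holomorphic_derivI[of g "ball s0 r"]) auto
    then have "((\<lambda>w. (w - s0) ^ n * g w) has_field_derivative 
        (of_nat n * (w - s0) ^ (n - 1) * g w + (w - s0) ^ n * deriv g w)) (at w)"
      by (auto intro!: derivative_eq_intros)
    then have "(f has_field_derivative (of_nat n * (w - s0) ^ (n - 1) * g w + (w - s0) ^ n * deriv g w)) (at w)"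
      by (rule has_field_derivative_transform_within_open[where S = "ball s0 r"]) (use elim g(5) in auto)
    then have d: "deriv f w = of_nat n * (w - s0) ^ (n - 1) * g w + (w - s0) ^ n * deriv g w"
      by (rule DERIV_imp_deriv)
    have "(w - s0) * deriv f w = of_nat n * ((w - s0) ^ n * g w) + (w - s0) * ((w - s0) ^ n * deriv g w)"
      unfolding d using g(1) by (cases n) (auto simp: algebra_simps)
    then have "(w - s0) * deriv f w / f w = 
                 (of_nat n * ((w - s0) ^ n * g w)) / ((w - s0) ^ n * g w) + ((w - s0) * ((w - s0) ^ n * deriv g w)) / ((w - s0) ^ n * g w)"
      using elim g(5)[of w] by (simp add: add_divide_distrib)
    moreover have "(w - s0) ^ n \<noteq> 0" "g w \<noteq> 0" using elim g(6)[of w] by auto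
    ultimately show ?case by simp
  qed
  ultimately have "((\<lambda>s. (s - s0) * deriv f s / f s) \<longlongrightarrow> of_nat n) (at s0)"
    using Lim_transform_eventually by force
  moreover have "eventually (\<lambda>s. f s \<noteq> 0) (at s0)"
    using near by eventually_elim (use g(5,6) in auto)
  ultimately show ?thesis using that[of n] g(1) True by simp
qed

lemma open_connected_Re_gt: "open {s. Re s > c}" "connected {s. Re s > c}"
  by (auto simp: open_halfspace_Re_gt convex_connected convex_halfspace_Re_gt)

text \<open>
  A zero of order n > 0 would give \<zeta>'/\<zeta> a pole with residue n. But \<zeta>'/\<zeta> equals minus the Dirichlet series
  of \<Lambda>, which is continuous on Re s > 1.
\<close>
lemma zeta_nonzero:
  assumes s: "Re s > 1"
  shows "zeta s \<noteq> 0"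
proof
  assume zero: "zeta s = 0"
  have holo: "zeta holomorphic_on {s. Re s > 1}"
    using zeta_sums(3) by (auto simp: holomorphic_on_def intro: field_differentiable_at_within)
  \<comment> \<open>The zero has finite order since zeta does not vanish identically: otherwise zeta_reg would vanish at 1 by continuity.\<close>
  obtain z where z: "Re z > 1" "zeta z \<noteq> 0"
  proof -
    have "isCont zeta_reg 1"
      using holomorphic_on_imp_continuous_on[OF zeta_reg_holomorphic] 
      by (simp add: continuous_on_eq_continuous_at open_halfspace_Re_gt)
    then have "((\<lambda>n. zeta_reg (1 + 1 / of_nat (Suc n))) \<longlongrightarrow> zeta_reg 1) sequentially"
      by (rule isCont_tendsto_compose) (rule tendsto_eq_intros LIMSEQ_Suc[OF lim_1_over_n] | simp)+
    then have "eventually (\<lambda>n. zeta_reg (1 + 1 / of_nat (Suc n)) \<noteq> 0) sequentially"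
      by (rule tendsto_imp_eventually_ne) (simp add: zeta_reg_1)
    then obtain n where "zeta_reg (1 + 1 / of_nat (Suc n)) \<noteq> 0"
      by (auto simp: eventually_sequentially)
    moreover have "Re (1 + 1 / of_nat (Suc n)) > 1" by (simp add: Re_divide_of_nat del: of_nat_Suc)
    ultimately show ?thesis using that[of "1 + 1 / of_nat (Suc n)"] zeta_reg_eq[of "1 + 1 / of_nat (Suc n)"] 
      by (simp del: of_nat_Suc)
  qed
  obtain n where n: "((\<lambda>w. (w - s) * deriv zeta w / zeta w) \<longlongrightarrow> of_nat n) (at s)" "n > 0" 
     "eventually (\<lambda>w. zeta w \<noteq> 0) (at s)"
    using log_deriv_tendsto_order[OF holo open_connected_Re_gt, of s z] s z zero by auto
  have "isCont mangoldt_series s"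
    by (intro field_differentiable_imp_continuous_at mangoldt_series s)
  then have "((\<lambda>w. (w - s) * (- mangoldt_series w)) \<longlongrightarrow> (s - s) * (- mangoldt_series s)) (at s)"
    unfolding isCont_def by (intro tendsto_intros)
  moreover have "eventually (\<lambda>w. Re w > 1) (at s)"
    using eventually_at_in_open'[OF open_halfspace_Re_gt, of s 1] s by simp
  then have "eventually (\<lambda>w. (w - s) * (- mangoldt_series w) = (w - s) * deriv zeta w / zeta w) (at s)"
    using n(3)
  proof eventually_elim
    case (elim w)
    from mangoldt_series_mult_zeta[OF elim(1)] have "deriv zeta w = - mangoldt_series w * zeta w" by simp
    then show ?case using elim(2) by simp
  qed
  ultimately have "((\<lambda>w. (w - s) * deriv zeta w / zeta w) \<longlongrightarrow> 0) (at s)"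
    using Lim_transform_eventually by fastforce
  with n(1) have "of_nat n = (0 :: complex)" using tendsto_unique by force
  with n(2) show False by simp
qed

lemma mangoldt_series_eq:
  assumes s: "Re s > 1"
  shows "mangoldt_series s = 1 / (s - 1) - deriv zeta_reg s / zeta_reg s"
proof -
  have s1: "s \<noteq> 1" using s by auto
  have "(zeta has_field_derivative deriv zeta s) (at s)"
    using zeta_sums(3)[OF s] by (simp add: field_differentiable_derivI)
  then have "((\<lambda>s. (s - 1) * zeta s) has_field_derivative (zeta s + (s - 1) * deriv zeta s)) (at s)"
    by (auto intro!: derivative_eq_intros)
  then have "(zeta_reg has_field_derivative (zeta s + (s - 1) * deriv zeta s)) (at s)"
    by (rule has_field_derivative_transform_within_open[where S = "{s. Re s > 1}"])
       (use s in \<open>auto simp: open_halfspace_Re_gt zeta_reg_eq\<close>)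
  then have "deriv zeta_reg s = zeta s + (s - 1) * deriv zeta s" by (rule DERIV_imp_deriv)
  moreover have "deriv zeta s = - mangoldt_series s * zeta s" using mangoldt_series_mult_zeta[OF s] by simp
  ultimately have d: "deriv zeta_reg s = zeta s - (s - 1) * mangoldt_series s * zeta s" by simp
  show ?thesis
    unfolding d zeta_reg_eq[OF s] using zeta_nonzero[OF s] s1 by (simp add: diff_divide_distrib)
qed

text \<open>
  Being 1/(s - 1) - Z'/Z with Z = (s - 1) \<zeta>, the Dirichlet series of \<Lambda> has at most a simple pole at a point of
  the line Re s = 1, and a zero of Z of order n contributes -n to the residue.
\<close>
lemma mangoldt_series_boundary:
  assumes s0: "Re s0 = 1"
  obtains n :: nat where 
    "((\<lambda>e::real. e * mangoldt_series (s0 + e)) \<longlongrightarrow> (if s0 = 1 then 1 else 0) - of_nat n) (at_right 0)"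
    "zeta_reg s0 = 0 \<longleftrightarrow> n > 0"
proof -
  obtain n where n: "((\<lambda>s. (s - s0) * deriv zeta_reg s / zeta_reg s) \<longlongrightarrow> of_nat n) (at s0)"
     "zeta_reg s0 = 0 \<longleftrightarrow> n > 0"
    using log_deriv_tendsto_order[OF zeta_reg_holomorphic open_connected_Re_gt, of s0 1] s0 zeta_reg_1 by auto
  have "((\<lambda>s. (s - s0) * (1 / (s - 1))) \<longlongrightarrow> (if s0 = 1 then 1 else 0)) (at s0)"
  proof (cases "s0 = 1")
    case True
    have A: "((\<lambda>s. 1) \<longlongrightarrow> (1::complex)) (at s0)" by simp
    have "eventually (\<lambda>s. 1 = (s - s0) * (1 / (s - 1))) (at s0)"
      using eventually_neq_at_within[of s0] by eventually_elim (use True in auto)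
    from Lim_transform_eventually[OF A this] show ?thesis using True by simp
  next
    case False
    then have "((\<lambda>s. (s - s0) * (1 / (s - 1))) \<longlongrightarrow> (s0 - s0) * (1 / (s0 - 1))) (at s0)"
      by (intro tendsto_intros) auto
    then show ?thesis using False by simp
  qed
  from tendsto_diff[OF this n(1)]
  have 1: "((\<lambda>s. (s - s0) * (1 / (s - 1)) - (s - s0) * deriv zeta_reg s / zeta_reg s) \<longlongrightarrow> 
              (if s0 = 1 then 1 else 0) - of_nat n) (at s0)" .
  have "filterlim (\<lambda>e::real. s0 + of_real e) (at s0) (at_right 0)"
    unfolding filterlim_at
  proof
    show "((\<lambda>e::real. s0 + of_real e) \<longlongrightarrow> s0) (at_right 0)"
      by (rule tendsto_eq_intros | simp)+
    show "\<forall>\<^sub>F e::real in at_right 0. s0 + of_real e \<in> UNIV \<and> s0 + of_real e \<noteq> s0"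
      using eventually_at_right_less[of 0] by eventually_elim auto
  qed
  from filterlim_compose[OF 1 this]
  have "((\<lambda>e::real. e * (1 / (s0 + e - 1)) - e * deriv zeta_reg (s0 + e) / zeta_reg (s0 + e)) \<longlongrightarrow> 
              (if s0 = 1 then 1 else 0) - of_nat n) (at_right 0)" by simp
  moreover have "eventually (\<lambda>e::real. e * (1 / (s0 + e - 1)) - e * deriv zeta_reg (s0 + e) / zeta_reg (s0 + e) 
                    = e * mangoldt_series (s0 + e)) (at_right 0)"
    using eventually_at_right_less[of 0]
  proof eventually_elim
    case (elim e)
    show ?case by (subst mangoldt_series_eq) (use elim s0 in \<open>auto simp: algebra_simps\<close>)
  qed
  ultimately have "((\<lambda>e::real. e * mangoldt_series (s0 + e)) \<longlongrightarrow> (if s0 = 1 then 1 else 0) - of_nat n) (at_right 0)"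
    by (rule Lim_transform_eventually)
  then show ?thesis using that n(2) by blast
qed

text \<open>
  Termwise this is 3 + 4 cos x + cos (2 x) = 2 (1 + cos x)^2 \<ge> 0.
\<close>
lemma mangoldt_series_3_4_1:
  assumes "e > 0"
  shows "0 \<le> 3 * Re (mangoldt_series (1 + of_real e)) + 4 * Re (mangoldt_series (Complex 1 t + of_real e))
             + Re (mangoldt_series (Complex 1 (2 * t) + of_real e))"
proof -
  have sums: "(\<lambda>n. mangoldt n * (real n powr (- 1 - e) * cos (u * ln (real n)))) sums Re (mangoldt_series (Complex 1 u + of_real e))" for u
  proof -
    have eq: "Re (mangoldt n * of_nat n powr (- (Complex 1 u + of_real e))) = mangoldt n * (real n powr (- 1 - e) * cos (u * ln (real n)))" for n
    proof (cases "n = 0")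
      case False
      then have "(of_nat n :: complex) powr (- (Complex 1 u + of_real e)) = exp (- (Complex 1 u + of_real e) * of_real (ln (real n)))"
        by (simp add: powr_def)
      also have "Re \<dots> = real n powr (- 1 - e) * cos (u * ln (real n))"
        using False by (simp add: Re_exp powr_def cos_minus algebra_simps)
      finally show ?thesis by simp
    qed auto
    have "Re (Complex 1 u + of_real e) > 1" using assms by simp
    from sums_Re[OF mangoldt_series(1)[OF this]] show ?thesis unfolding eq .
  qed
  have "(\<lambda>n. 3 * (mangoldt n * (real n powr (- 1 - e) * cos (0 * ln (real n)))) 
        + 4 * (mangoldt n * (real n powr (- 1 - e) * cos (t * ln (real n)))) 
        + mangoldt n * (real n powr (- 1 - e) * cos (2 * t * ln (real n)))) sums 
      (3 * Re (mangoldt_series (Complex 1 0 + of_real e)) + 4 * Re (mangoldt_series (Complex 1 t + of_real e))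
             + Re (mangoldt_series (Complex 1 (2 * t) + of_real e)))"
    by (intro sums_add sums_mult sums)
  moreover have "3 * (mangoldt n * (real n powr (- 1 - e) * cos (0 * ln (real n)))) 
        + 4 * (mangoldt n * (real n powr (- 1 - e) * cos (t * ln (real n)))) 
        + mangoldt n * (real n powr (- 1 - e) * cos (2 * t * ln (real n))) \<ge> 0" for n
  proof -
    have "cos (2 * t * ln (real n)) = 2 * (cos (t * ln (real n)))\<^sup>2 - 1"
      using cos_double_cos[of "t * ln (real n)"] by (simp add: mult.assoc)
    note c = this
    have "3 * (mangoldt n * (real n powr (- 1 - e) * cos (0 * ln (real n)))) 
        + 4 * (mangoldt n * (real n powr (- 1 - e) * cos (t * ln (real n)))) 
        + mangoldt n * (real n powr (- 1 - e) * cos (2 * t * ln (real n)))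
        = mangoldt n * real n powr (- 1 - e) * (2 * (1 + cos (t * ln (real n)))\<^sup>2)"
      unfolding c by (simp add: algebra_simps power2_eq_square)
    also have "\<dots> \<ge> 0" by (intro mult_nonneg_nonneg mangoldt_nonneg) auto
    finally show ?thesis .
  qed
  ultimately have "0 \<le> 3 * Re (mangoldt_series (Complex 1 0 + of_real e)) + 4 * Re (mangoldt_series (Complex 1 t + of_real e))
             + Re (mangoldt_series (Complex 1 (2 * t) + of_real e))"
    by (rule sums_le[OF _ sums_zero, rotated])
  moreover have "Complex 1 0 = 1" by (simp add: complex_eq_iff)
  ultimately show ?thesis by simp
qed

text \<open>
  For t \<noteq> 0, if 1 + i t is a zero of order n1 \<ge> 0 and 1 + 2 i t one of order n2 \<ge> 0, then multiplying the 3-4-1 inequality by e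
  and letting e tend to 0 gives 3 - 4 n1 - n2 \<ge> 0, so n1 = 0.
\<close>
lemma zeta_reg_nonzero:
  assumes "Re s \<ge> 1"
  shows "zeta_reg s \<noteq> 0"
proof (cases "Re s > 1")
  case True
  then show ?thesis using zeta_reg_eq[OF True] zeta_nonzero[OF True] by auto
next
  case False
  define t where "t = Im s"
  have s: "s = Complex 1 t" using False assms by (simp add: t_def complex_eq_iff)
  show ?thesis
  proof (cases "t = 0")
    case True
    then have "s = 1" using s by (simp add: complex_eq_iff)
    then show ?thesis by (simp add: zeta_reg_1)
  next
    case t: False
    obtain n0 :: nat where n0: 
       "((\<lambda>e::real. e * mangoldt_series (1 + e)) \<longlongrightarrow> (if (1::complex) = 1 then 1 else 0) - of_nat n0) (at_right 0)"
       "zeta_reg 1 = 0 \<longleftrightarrow> n0 > 0"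
      using mangoldt_series_boundary[of 1] by auto
    obtain n1 :: nat where n1: 
       "((\<lambda>e::real. e * mangoldt_series (Complex 1 t + e)) \<longlongrightarrow> (if Complex 1 t = 1 then 1 else 0) - of_nat n1) (at_right 0)"
       "zeta_reg (Complex 1 t) = 0 \<longleftrightarrow> n1 > 0"
      using mangoldt_series_boundary[of "Complex 1 t"] by auto
    obtain n2 :: nat where n2: 
       "((\<lambda>e::real. e * mangoldt_series (Complex 1 (2*t) + e)) \<longlongrightarrow> (if Complex 1 (2*t) = 1 then 1 else 0) - of_nat n2) (at_right 0)"
      using mangoldt_series_boundary[of "Complex 1 (2*t)"] by auto
    have ne: "Complex 1 t \<noteq> 1" "Complex 1 (2 * t) \<noteq> 1" using t by (auto simp: complex_eq_iff)
    have "n0 = 0" using n0 zeta_reg_1 by simp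
    then have lim: "((\<lambda>e::real. 3 * Re (e * mangoldt_series (1 + e)) + 4 * Re (e * mangoldt_series (Complex 1 t + e)) 
        + Re (e * mangoldt_series (Complex 1 (2*t) + e))) \<longlongrightarrow> 3 * Re (1 - of_nat n0) + 4 * Re (0 - of_nat n1) + Re (0 - of_nat n2)) (at_right 0)"
      using n0 n1 n2 ne by (intro tendsto_add tendsto_mult tendsto_const tendsto_Re) auto
    have "0 \<le> 3 * Re (1 - of_nat n0) + 4 * Re (0 - of_nat n1) + Re (0 - of_nat n2)"
    proof (rule tendsto_lowerbound[OF lim])
      show "\<forall>\<^sub>F e::real in at_right 0. 0 \<le> 3 * Re (e * mangoldt_series (1 + e)) + 4 * Re (e * mangoldt_series (Complex 1 t + e)) 
        + Re (e * mangoldt_series (Complex 1 (2*t) + e))"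
        using eventually_at_right_less[of 0]
      proof eventually_elim
        case (elim e)
        have "0 \<le> e * (3 * Re (mangoldt_series (1 + of_real e)) + 4 * Re (mangoldt_series (Complex 1 t + of_real e))
             + Re (mangoldt_series (Complex 1 (2 * t) + of_real e)))"
          using elim by (intro mult_nonneg_nonneg mangoldt_series_3_4_1) auto
        then show ?case by (simp add: algebra_simps)
      qed
    qed auto
    then have "n1 = 0" using \<open>n0 = 0\<close> by simp
    then show ?thesis using n1 s by simp
  qed
qed

section \<open>Elementary bounds for sums of powers\<close>

lemma powr_diff_MVT:
  fixes a y :: real
  assumes "a > 0" "y \<noteq> 0"
  obtains c where "a < c" "c < a + 1" "((a + 1) powr y - a powr y) / y = c powr (y - 1)"
proof -
  have "\<exists>z>a. z < a + 1 \<and> (a + 1) powr y - a powr y = (a + 1 - a) * (y * z powr (y - 1))"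
    using assms by (intro MVT2) (auto intro!: derivative_eq_intros)
  with that assms show ?thesis by auto
qed

text \<open>
  Each summand is compared with a difference of the primitive x powr y / y. For y \<ge> 1 the summands increase
  and the interval to the right of n is used, which leaves over the last summand. For y < 1 they decrease and
  the interval to the left is used.
\<close>
lemma sum_powr_le:
  fixes y :: real
  assumes "y > 0"
  shows "(\<Sum>n=1..N. real n powr (y - 1)) \<le> real N powr y / y + real N powr (y - 1)"
proof (cases "y \<ge> 1")
  case True
  show ?thesis
  proof (induction N)
    case (Suc N)
    show ?case
    proof (cases "N = 0")
      case False
      obtain c where c: "real N < c" "((real N + 1) powr y - real N powr y) / y = c powr (y - 1)"
        using powr_diff_MVT[of "real N" y] False assms by auto
      have "real N powr (y - 1) \<le> c powr (y - 1)" using c True by (intro powr_mono2) auto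
      then show ?thesis using Suc c(2) by (simp add: diff_divide_distrib add_ac)
    qed (use assms in auto)
  qed (use assms in auto)
next
  case False
  have "(\<Sum>n=1..N. real n powr (y - 1)) \<le> real N powr y / y"
  proof (induction N)
    case (Suc N)
    show ?case
    proof (cases "N = 0")
      case False
      obtain c where c: "real N < c" "c < real N + 1" "((real N + 1) powr y - real N powr y) / y = c powr (y - 1)"
        using powr_diff_MVT[of "real N" y] False assms by auto
      have "(real N + 1) powr (y - 1) \<le> c powr (y - 1)" using c \<open>\<not> y \<ge> 1\<close> by (intro powr_mono2') auto
      then show ?thesis using Suc c(3) by (simp add: diff_divide_distrib add_ac)
    qed (use assms \<open>\<not> y \<ge> 1\<close> in \<open>auto simp: field_simps\<close>)
  qed (use assms in auto)
  then show ?thesis by (smt (verit) powr_ge_zero)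
qed

lemma sum_powr_tail_le:
  fixes x :: real
  assumes "x > 0" "N > 0"
  shows "(\<Sum>n=Suc N..M. real n powr (- x - 1)) \<le> real N powr (- x) / x"
proof (cases "N \<le> M")
  case True
  have "(\<Sum>n=Suc N..M. real n powr (- x - 1)) \<le> (real N powr (- x) - real M powr (- x)) / x"
    using True
  proof (induction M rule: dec_induct)
    case (step M)
    obtain c where c: "real M < c" "c < real M + 1" 
        "((real M + 1) powr (-x) - real M powr (-x)) / (-x) = c powr (- x - 1)"
      using powr_diff_MVT[of "real M" "-x"] step assms by auto
    have "(real M + 1) powr (- x - 1) \<le> c powr (- x - 1)" using c assms step by (intro powr_mono2') auto
    then show ?case using step c(3) by (simp add: diff_divide_distrib add_ac)
  qed auto
  also have "\<dots> \<le> real N powr (- x) / x" using assms by (simp add: divide_right_mono)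
  finally show ?thesis .
qed (use assms in auto)

section \<open>The Cauchy formula on two half-circles\<close>

text \<open>
  The circle of radius R is cut at i R and - i R, since the Dirichlet series and its partial sums are estimated
  differently on the two sides of the imaginary axis.
\<close>
abbreviation "right_arc R \<equiv> part_circlepath 0 R (-pi/2) (pi/2)"
abbreviation "left_arc R \<equiv> part_circlepath 0 R (pi/2) (3*pi/2)"

lemma exp_pi_half: "exp (\<i> * complex_of_real (pi / 2)) = \<i>" "exp (\<i> * complex_of_real (- pi / 2)) = - \<i>"
   "exp (\<i> * complex_of_real (3 * pi / 2)) = - \<i>"
proof -
  show 1: "exp (\<i> * complex_of_real (pi / 2)) = \<i>" "exp (\<i> * complex_of_real (- pi / 2)) = - \<i>"
    unfolding cis_conv_exp [symmetric] by (auto simp: complex_eq_iff)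
  have "exp (\<i> * complex_of_real (3 * pi / 2)) = exp (\<i> * complex_of_real (- pi / 2) + 2 * of_real pi * \<i>)"
    by (simp add: algebra_simps)
  also have "\<dots> = - \<i>" using 1(2) by (simp only: exp_add) simp
  finally show "exp (\<i> * complex_of_real (3 * pi / 2)) = - \<i>" .
qed

lemma arc_ends [simp]: 
  "pathstart (right_arc R) = - \<i> * R" "pathfinish (right_arc R) = \<i> * R"
  "pathstart (left_arc R) = \<i> * R" "pathfinish (left_arc R) = - \<i> * R"
  unfolding pathstart_part_circlepath pathfinish_part_circlepath exp_pi_half by auto

lemma right_arc_image: assumes "R > 0" "w \<in> path_image (right_arc R)" shows "norm w = R" "Re w \<ge> 0"
proof -
  obtain t where t: "w = R * cis t" "-pi/2 \<le> t" "t \<le> pi/2" 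
    using assms(2) unfolding path_image_part_circlepath' closed_segment_eq_real_ivl by fastforce
  show "norm w = R" "Re w \<ge> 0" using t assms(1) by (auto simp: norm_mult cos_ge_zero)
qed

lemma left_arc_image: assumes "R > 0" "w \<in> path_image (left_arc R)" shows "norm w = R" "Re w \<le> 0"
proof -
  obtain t where t: "w = R * cis t" "pi/2 \<le> t" "t \<le> 3*pi/2" 
    using assms(2) unfolding path_image_part_circlepath' closed_segment_eq_real_ivl by fastforce
  have "cos t = - cos (t - pi)" by (simp add: cos_diff)
  moreover have "cos (t - pi) \<ge> 0" using t by (intro cos_ge_zero) auto
  ultimately have "cos t \<le> 0" by linarith
  then show "norm w = R" "Re w \<le> 0" using t assms(1) by (auto simp: norm_mult mult_nonneg_nonpos)
qed

lemma contour_integral_inverse_arc: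
  assumes "a < b" "R > 0"
  shows "((\<lambda>w. 1 / w) has_contour_integral (\<i> * of_real (b - a))) (part_circlepath 0 R a b)"
proof -
  have "((\<lambda>t. \<i>) has_integral ((b - a) *\<^sub>R \<i>)) {a..b}"
    using has_integral_const_real[of \<i> a b] assms by simp
  then have "((\<lambda>t. 1 / (0 + R * cis t) * R * \<i> * cis t) has_integral (\<i> * of_real (b - a))) {a..b}"
    using assms by (simp add: scaleR_conv_of_real mult.commute)
  then show ?thesis 
    unfolding has_contour_integral_part_circlepath_iff[OF assms(1)] .
qed

text \<open>
  Writing k(w)/w = (k(w) - k(0))/w + k(0)/w, the first part has a primitive, whose contributions from the two
  arcs cancel, and the second part contributes k(0) i times the total angle.
\<close>
lemma Cauchy_formula_two_arcs:
  assumes holo: "k holomorphic_on UNIV" and R: "R > 0"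
  shows "contour_integral (right_arc R) (\<lambda>w. k w / w) + contour_integral (left_arc R) (\<lambda>w. k w / w) = 2 * pi * \<i> * k 0"
proof -
  define q where "q = (\<lambda>w. if w = 0 then deriv k 0 else (k w - k 0) / (w - 0))"
  have q: "q holomorphic_on UNIV" unfolding q_def by (rule pole_lemma_open) (use holo in auto)
  then obtain Q where Q: "\<And>w. (Q has_field_derivative q w) (at w)"
    using holomorphic_convex_primitive'[of UNIV q] by auto
  have arc: "((\<lambda>w. k w / w) has_contour_integral (Q (pathfinish p) - Q (pathstart p) + k 0 * (\<i> * of_real (b - a)))) p"
    if ab: "a < b" and p: "p = part_circlepath 0 R a b" for p a b
  proof -
    have 1: "(q has_contour_integral (Q (pathfinish p) - Q (pathstart p))) p"
      using contour_integral_primitive[of UNIV Q q p] Q p by auto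
    have 2: "((\<lambda>w. k 0 * (1 / w)) has_contour_integral (k 0 * (\<i> * of_real (b - a)))) p"
      unfolding p by (rule has_contour_integral_lmul[OF contour_integral_inverse_arc[OF ab R]])
    have "((\<lambda>w. q w + k 0 * (1 / w)) has_contour_integral (Q (pathfinish p) - Q (pathstart p) + k 0 * (\<i> * of_real (b - a)))) p"
      by (rule has_contour_integral_add[OF 1 2])
    moreover have "q w + k 0 * (1 / w) = k w / w" if "w \<in> path_image p" for w
    proof -
      have "w \<noteq> 0" using that R ab unfolding p path_image_part_circlepath' by auto
      then show ?thesis by (simp add: q_def field_simps)
    qed
    ultimately show ?thesis by (rule has_contour_integral_eq) 
  qed
  have 1: "contour_integral (right_arc R) (\<lambda>w. k w / w) 
          = Q (\<i> * R) - Q (- \<i> * R) + k 0 * (\<i> * of_real (pi/2 - (-pi/2)))"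
    using contour_integral_unique[OF arc[of "-pi/2" "pi/2" "right_arc R", OF _ refl]] 
    unfolding arc_ends by simp
  have 2: "contour_integral (left_arc R) (\<lambda>w. k w / w) 
          = Q (- \<i> * R) - Q (\<i> * R) + k 0 * (\<i> * of_real (3*pi/2 - pi/2))"
    using contour_integral_unique[OF arc[of "pi/2" "3*pi/2" "left_arc R", OF _ refl]] 
    unfolding arc_ends by simp
  show ?thesis unfolding 1 2 by (simp add: field_simps)
qed

section \<open>Newman's Tauberian theorem\<close>

text \<open>
  A Riemann-Lebesgue lemma: on the imaginary axis of_nat N powr w has modulus 1, and integrating by parts gains
  a factor 1 / ln N. The boundary terms vanish because u is zero at both ends.
\<close>
lemma linepath_oscillating_integral_tendsto_0:
  assumes u: "u holomorphic_on T" "open T" "closed_segment a b \<subseteq> T" "u a = 0" "u b = 0"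
    and ab: "Re a = 0" "Re b = 0"
  shows "(\<lambda>N. contour_integral (linepath a b) (\<lambda>w. u w * of_nat N powr w)) \<longlonglongrightarrow> 0"
proof -
  have Re: "Re w = 0" if "w \<in> closed_segment a b" for w
    using that ab by (auto simp: in_segment)
  have u': "deriv u holomorphic_on T" using u by (intro holomorphic_deriv) auto
  have "compact (deriv u ` closed_segment a b)"
    by (intro compact_continuous_image holomorphic_on_imp_continuous_on holomorphic_on_subset[OF u' u(3)]) auto
  from compact_imp_bounded[OF this] obtain M where "\<forall>x\<in>deriv u ` closed_segment a b. norm x \<le> M"
    unfolding bounded_iff ..
  then have M: "norm (deriv u w) \<le> M" if "w \<in> closed_segment a b" for w
    using that by simp
  have M0: "M \<ge> 0" using M[of a] norm_ge_zero[of "deriv u a"] by (auto simp del: norm_ge_zero)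
  show ?thesis
  proof (rule Lim_null_comparison)
    show "(\<lambda>N. (M / ln (real N)) * norm (b - a)) \<longlonglongrightarrow> 0" by real_asymp
    show "\<forall>\<^sub>F N in sequentially. norm (contour_integral (linepath a b) (\<lambda>w. u w * of_nat N powr w)) \<le> (M / ln (real N)) * norm (b - a)"
      using eventually_gt_at_top[of 1]
    proof eventually_elim
      case (elim N)
      then have lnN: "ln (real N) > 0" by simp
      define l where "l = complex_of_real (ln (real N))"
      have l: "l \<noteq> 0" "norm l = ln (real N)" using lnN by (auto simp: l_def)
      have lN: "Ln (of_nat N) = l" using elim by (simp add: l_def)
      have int: "((\<lambda>w. (deriv u w / l) * of_nat N powr w + u w * of_nat N powr w) has_contour_integral 
               (u b / l * of_nat N powr b - u a / l * of_nat N powr a)) (linepath a b)"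
      proof -
        have "((\<lambda>w. u w / l * of_nat N powr w) has_field_derivative 
                   (deriv u w / l) * of_nat N powr w + u w * of_nat N powr w) (at w within closed_segment a b)"
          if w: "w \<in> closed_segment a b" for w
        proof -
          have "(u has_field_derivative deriv u w) (at w)"
            using u w by (intro holomorphic_derivI[of u T]) auto
          then have "((\<lambda>w. u w / l * of_nat N powr w) has_field_derivative 
                   (deriv u w / l) * of_nat N powr w + u w / l * (Ln (of_nat N) * of_nat N powr w)) (at w)"
            using elim l by (auto intro!: derivative_eq_intros has_field_derivative_powr_right 
                simp: add_divide_distrib mult_ac)
          then have "((\<lambda>w. u w / l * of_nat N powr w) has_field_derivative 
                   (deriv u w / l) * of_nat N powr w + u w * of_nat N powr w) (at w)"
            using l lN by simp
          then show ?thesis by (rule has_field_derivative_at_within)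
        qed
        from contour_integral_primitive[OF this, of "linepath a b"] show ?thesis by simp
      qed
      have c: "(\<lambda>w. (deriv u w / l) * of_nat N powr w) contour_integrable_on linepath a b"
        using elim l by (intro contour_integrable_continuous_linepath holomorphic_on_imp_continuous_on holomorphic_intros 
            holomorphic_on_subset[OF u' u(3)]) auto
      have c2: "(\<lambda>w. u w * of_nat N powr w) contour_integrable_on linepath a b"
        using elim by (intro contour_integrable_continuous_linepath holomorphic_on_imp_continuous_on holomorphic_intros 
            holomorphic_on_subset[OF u(1) u(3)]) auto
      have "contour_integral (linepath a b) (\<lambda>w. u w * of_nat N powr w) 
              = - contour_integral (linepath a b) (\<lambda>w. (deriv u w / l) * of_nat N powr w)"
        using contour_integral_unique[OF int] contour_integral_add[OF c c2] u(4,5) 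
        by (simp add: add_eq_0_iff)
      moreover have "norm (contour_integral (linepath a b) (\<lambda>w. (deriv u w / l) * of_nat N powr w)) 
                      \<le> (M / ln (real N)) * norm (b - a)"
      proof (rule contour_integral_bound_linepath[OF c])
        show "0 \<le> M / ln (real N)" using M0 lnN by simp
        fix w assume w: "w \<in> closed_segment a b"
        then show "norm ((deriv u w / l) * of_nat N powr w) \<le> M / ln (real N)"
          using Re[OF w] M[OF w] elim l lnN by (simp add: norm_mult norm_divide norm_of_nat_powr divide_right_mono)
      qed
      ultimately show ?case by simp
    qed
  qed
qed

text \<open>
  On the circle, 1/w + w/R^2 is real and proportional to Re w. It thus cancels the factor 1 / Re w in the
  bounds for tails and partial sums of the Dirichlet series.
\<close>
lemma newman_kernel:
  fixes w :: complex and R :: real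
  assumes "norm w = R" "R > 0"
  shows "1 / w + w / R\<^sup>2 = of_real (2 * Re w / R\<^sup>2)" "(1 + w\<^sup>2 / R\<^sup>2) / w = 1 / w + w / R\<^sup>2"
proof -
  have w: "w \<noteq> 0" using assms by auto
  have "1 / w = cnj w / of_real (R\<^sup>2)"
    using w assms complex_norm_square[of w] by (simp add: field_simps)
  then show "1 / w + w / R\<^sup>2 = of_real (2 * Re w / R\<^sup>2)"
    using complex_add_cnj[of w] by (simp add: add.commute flip: add_divide_distrib)
  show "(1 + w\<^sup>2 / R\<^sup>2) / w = 1 / w + w / R\<^sup>2"
    using w by (simp add: add_divide_distrib power2_eq_square)
qed

text \<open>
  The cancellations in the bounds on the two arcs, with p and p' standing for N powr (- Re w) and N powr (Re w),
  x for Re w, D for the square of R, and M for N.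
\<close>
lemma newman_bound_identities:
  fixes x p p' C D M R :: real
  shows "x > 0 \<Longrightarrow> C * (p / x) * (p' * (2 * \<bar>x\<bar> / D)) = 2 * C / D * (p * p')"
    and "x < 0 \<Longrightarrow> C * (p / (- x) + p / M) * (p' * (2 * \<bar>x\<bar> / D)) = (p * p') * (2 * C / D + 2 * C / M * (- x) / D)"
    and "R > 0 \<Longrightarrow> 2 * C / M * R / R\<^sup>2 = 2 * C / (M * R)"
    and "R > 0 \<Longrightarrow> (2 * C / R\<^sup>2 + 2 * C / (M * R)) * R * \<bar>3*pi/2 - pi/2\<bar> = 2 * pi * (C / R + C / M)"
proof -
  show "x > 0 \<Longrightarrow> C * (p / x) * (p' * (2 * \<bar>x\<bar> / D)) = 2 * C / D * (p * p')"
    by simp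
  show "R > 0 \<Longrightarrow> 2 * C / M * R / R\<^sup>2 = 2 * C / (M * R)"
    by (simp add: power2_eq_square)
  show "(2 * C / R\<^sup>2 + 2 * C / (M * R)) * R * \<bar>3*pi/2 - pi/2\<bar> = 2 * pi * (C / R + C / M)" if "R > 0"
  proof -
    have "2 * C / R\<^sup>2 * R = 2 * (C / R)" "2 * C / (M * R) * R = 2 * (C / M)"
      using that by (simp_all add: power2_eq_square)
    moreover have "\<bar>3*pi/2 - pi/2\<bar> = pi" by simp
    ultimately show ?thesis by (simp only: distrib_right) (simp add: algebra_simps)
  qed
  assume "x < 0"
  then have "p / (- x) * \<bar>x\<bar> = p" by simp
  then have "2 * C * p' / D * (p / (- x) * \<bar>x\<bar>) + 2 * C * p' / D * (p / M * \<bar>x\<bar>) = 2 * C * p' / D * p + 2 * C * p' / D * (p / M * (-x))"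
    using \<open>x < 0\<close> by simp
  then show "C * (p / (- x) + p / M) * (p' * (2 * \<bar>x\<bar> / D)) = (p * p') * (2 * C / D + 2 * C / M * (- x) / D)"
    by (simp add: algebra_simps)
qed

text \<open>
  Put g(w) = f(1 + w), let h N be the N-th partial sum as a function of w, and let K(w) = N^w (1 + w^2/R^2), so
  K(0) = 1. Cauchy's formula expresses h N 0 by the integrals of h N w * K w / w over both arcs. The integral
  over the left arc is small by the bound on the partial sums. On the right arc the partial sum is replaced by g,
  with an error controlled by the tail of the series. These errors add up to O(C/R) + O(C/N). Finally g(w)/w is
  holomorphic because g(0) = 0, so the integral of K(w) g(w)/w over the right arc equals the one over the segment from - i R to i R, which tends to 0 as N grows. Letting first N
  and then R tend to infinity gives the claim.
\<close>
lemma newman_tauberian_vanishing: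
  fixes a :: "nat \<Rightarrow> complex"
  assumes a: "\<And>n. norm (a n) \<le> C" 
    and S: "open S" "{s. Re s \<ge> 1} \<subseteq> S" and f: "f holomorphic_on S"
    and sums: "\<And>s. Re s > 1 \<Longrightarrow> (\<lambda>n. a n * of_nat n powr (- s)) sums f s"
    and f1: "f 1 = 0"
  shows "(\<lambda>N. \<Sum>n\<le>N. a n / of_nat n) \<longlonglongrightarrow> 0"
proof -
  have C: "C \<ge> 0" using a[of 0] norm_ge_zero[of "a 0"] by (simp del: norm_ge_zero)
  define g where "g = (\<lambda>w. f (1 + w))"
  define h where "h = (\<lambda>N w. \<Sum>n\<le>N. a n * of_nat n powr (- (1 + w)))"
  define T where "T = (+) (-1) ` S"
  have T: "open T" unfolding T_def by (rule open_translation) (rule S)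
  have T_iff: "w \<in> T \<longleftrightarrow> 1 + w \<in> S" for w unfolding T_def by (force simp: image_iff)
  have Re_T: "{w. Re w \<ge> 0} \<subseteq> T"
  proof
    fix w assume "w \<in> {w. Re w \<ge> 0}"
    then have "1 + w \<in> {s. Re s \<ge> 1}" by simp
    then show "w \<in> T" using S(2) T_iff by blast
  qed
  have g: "g holomorphic_on T"
    unfolding g_def
    by (rule holomorphic_on_compose_gen[of "\<lambda>w. 1 + w" T f S, unfolded o_def])
       (auto intro!: holomorphic_intros f simp: T_iff)
  define q where "q = (\<lambda>w. if w = 0 then deriv g 0 else (g w - g 0) / (w - 0))"
  have q: "q holomorphic_on T" unfolding q_def by (rule pole_lemma_open[OF g T])
  have gq: "g w = w * q w" for w using f1 by (simp add: q_def g_def)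

  have term_bound: "norm (a n * of_nat n powr (- (1 + w))) \<le> C * real n powr (- Re w - 1)" if "n > 0" for n w
  proof -
    have e: "Re (- (1 + w)) = - Re w - 1" by simp
    have "norm (a n * of_nat n powr (- (1 + w))) = norm (a n) * real n powr (- Re w - 1)"
      unfolding norm_mult norm_of_nat_powr[OF that] e ..
    then show ?thesis using a[of n] by (simp add: mult_right_mono)
  qed

  have tail: "norm (g w - h N w) \<le> C * (real N powr (- Re w) / Re w)" if w: "Re w > 0" and N: "N > 0" for w N
  proof -
    have "(\<lambda>M. h M w) \<longlonglongrightarrow> g w"
      using sums[of "1 + w"] w unfolding sums_def_le g_def h_def by simp
    then have "(\<lambda>M. h M w - h N w) \<longlonglongrightarrow> g w - h N w" by (intro tendsto_intros)
    then show ?thesis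
    proof (rule Lim_norm_ubound[rotated])
      show "\<forall>\<^sub>F M in sequentially. norm (h M w - h N w) \<le> C * (real N powr (- Re w) / Re w)"
        using eventually_ge_at_top[of N]
      proof eventually_elim
        case (elim M)
        have "{..M} = {..N} \<union> {Suc N..M}" using elim by auto
        then have "h M w - h N w = (\<Sum>n=Suc N..M. a n * of_nat n powr (- (1 + w)))"
          unfolding h_def by (simp only:) (subst sum.union_disjoint, auto)
        also have "norm \<dots> \<le> (\<Sum>n=Suc N..M. C * real n powr (- Re w - 1))"
        proof (rule sum_norm_le)
          fix n assume "n \<in> {Suc N..M}"
          then show "norm (a n * of_nat n powr (- (1 + w))) \<le> C * real n powr (- Re w - 1)"
            by (intro term_bound) auto
        qed
        also have "\<dots> = C * (\<Sum>n=Suc N..M. real n powr (- Re w - 1))" by (simp add: sum_distrib_left)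
        also have "\<dots> \<le> C * (real N powr (- Re w) / Re w)"
          by (intro mult_left_mono sum_powr_tail_le w C) (use N in auto)
        finally show ?case .
      qed
    qed auto
  qed

  have partial: "norm (h N w) \<le> C * (real N powr (- Re w) / (- Re w) + real N powr (- Re w - 1))" 
    if w: "Re w < 0" for w N
  proof -
    have "h N w = (\<Sum>n=1..N. a n * of_nat n powr (- (1 + w)))"
      unfolding h_def by (intro sum.mono_neutral_right) (auto simp: not_less_eq_eq)
    also have "norm \<dots> \<le> (\<Sum>n=1..N. C * real n powr (- Re w - 1))"
    proof (rule sum_norm_le)
      fix n assume "n \<in> {1..N}"
      then show "norm (a n * of_nat n powr (- (1 + w))) \<le> C * real n powr (- Re w - 1)"
        by (intro term_bound) auto
    qed
    also have "\<dots> = C * (\<Sum>n=1..N. real n powr (- Re w - 1))" by (simp add: sum_distrib_left)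
    also have "\<dots> \<le> C * (real N powr (- Re w) / (- Re w) + real N powr (- Re w - 1))"
      by (intro mult_left_mono sum_powr_le C) (use w in auto)
    finally show ?thesis .
  qed

  have main: "norm (h N 0) \<le> norm (contour_integral (linepath (- \<i> * R) (\<i> * R)) (\<lambda>w. q w * (1 + w\<^sup>2 / R\<^sup>2) * of_nat N powr w)) 
                 + 2 * C / R + C / N" if R: "R > 0" and N: "N > 0" for R :: real and N :: nat
  proof -
    define K where "K = (\<lambda>w::complex. (1 + w\<^sup>2 / R\<^sup>2) * of_nat N powr w)"
    have K: "K holomorphic_on X" for X unfolding K_def using N R by (intro holomorphic_intros) auto
    have K0: "K 0 = 1" using N by (simp add: K_def)
    have normK: "norm (K w / w) = real N powr Re w * (2 * \<bar>Re w\<bar> / R\<^sup>2)" if "norm w = R" for w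
    proof -
      have "K w / w = of_nat N powr w * ((1 + w\<^sup>2 / R\<^sup>2) / w)" by (simp add: K_def)
      also have "\<dots> = of_nat N powr w * of_real (2 * Re w / R\<^sup>2)"
        using newman_kernel[OF that R] by simp
      finally show ?thesis using N by (simp add: norm_mult norm_of_nat_powr norm_divide norm_power)
    qed
    have "(\<lambda>w. a n * of_nat n powr (- (1 + w))) holomorphic_on UNIV" for n
      by (cases "n = 0") (auto intro!: holomorphic_intros)
    then have h: "h N holomorphic_on UNIV" for N
      unfolding h_def by (intro holomorphic_on_sum)
    have "(\<lambda>w. h N w * K w) holomorphic_on UNIV" by (intro holomorphic_intros h K)
    from Cauchy_formula_two_arcs[OF this R]
    have cauchy: "contour_integral (right_arc R) (\<lambda>w. h N w * K w / w) + contour_integral (left_arc R) (\<lambda>w. h N w * K w / w) = 2 * pi * \<i> * h N 0"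
      by (simp add: K0)

    have nz: "w \<noteq> 0" if "norm w = R" for w :: complex using that R by auto
    have rsub: "path_image (right_arc R) \<subseteq> {w. Re w \<ge> 0}" using right_arc_image[OF R] by auto
    have ihr: "(\<lambda>w. h N w * K w / w) contour_integrable_on (right_arc R)"
      using right_arc_image[OF R] nz
      by (intro contour_integrable_continuous_part_circlepath continuous_intros holomorphic_on_imp_continuous_on 
          holomorphic_on_subset[OF h] K) auto
    have igr: "(\<lambda>w. q w * K w) contour_integrable_on (right_arc R)"
      using rsub Re_T
      by (intro contour_integrable_continuous_part_circlepath continuous_intros holomorphic_on_imp_continuous_on 
          holomorphic_on_subset[OF q] K) auto
    have ihl: "(\<lambda>w. h N w * K w / w) contour_integrable_on (left_arc R)"
      using left_arc_image[OF R] nz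
      by (intro contour_integrable_continuous_part_circlepath continuous_intros holomorphic_on_imp_continuous_on 
          holomorphic_on_subset[OF h] K) auto
    have seg: "closed_segment (\<i> * R) (- \<i> * R) \<subseteq> {w. Re w \<ge> 0}" by (auto simp: in_segment)
    have segT: "closed_segment (\<i> * R) (- \<i> * R) \<subseteq> T" using seg Re_T by blast
    then have segT': "closed_segment (- \<i> * R) (\<i> * R) \<subseteq> T" by (subst closed_segment_commute)
    have il: "(\<lambda>w. q w * K w) contour_integrable_on (linepath (\<i> * R) (- \<i> * R))"
      by (intro contour_integrable_continuous_linepath continuous_intros holomorphic_on_imp_continuous_on 
          holomorphic_on_subset[OF q segT] K)

    have "((\<lambda>w. q w * K w) has_contour_integral 0) (right_arc R +++ linepath (\<i> * R) (- \<i> * R))"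
    proof (rule Cauchy_theorem_convex_simple[of _ "{w. Re w \<ge> 0}"])
      show "(\<lambda>w. q w * K w) holomorphic_on {w. Re w \<ge> 0}"
        by (intro holomorphic_intros K holomorphic_on_subset[OF q Re_T])
      show "path_image (right_arc R +++ linepath (\<i> * R) (- \<i> * R)) \<subseteq> {w. Re w \<ge> 0}"
        using rsub seg path_image_join_subset[of "right_arc R" "linepath (\<i> * R) (- \<i> * R)"] 
        unfolding path_image_linepath by blast
      show "valid_path (right_arc R +++ linepath (\<i> * R) (- \<i> * R))"
        by (intro valid_path_join) (simp_all only: arc_ends valid_path_part_circlepath valid_path_linepath pathstart_linepath)
      show "pathfinish (right_arc R +++ linepath (\<i> * R) (- \<i> * R)) = pathstart (right_arc R +++ linepath (\<i> * R) (- \<i> * R))"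
        by (simp only: pathstart_join pathfinish_join arc_ends pathfinish_linepath)
    qed (auto simp: convex_halfspace_Re_ge)
    then have s0: "contour_integral (right_arc R) (\<lambda>w. q w * K w) + contour_integral (linepath (\<i> * R) (- \<i> * R)) (\<lambda>w. q w * K w) = 0"
      using contour_integral_join[OF igr il] contour_integral_unique by force
    have s1: "contour_integral (linepath (- \<i> * R) (\<i> * R)) (\<lambda>w. q w * K w) = - contour_integral (linepath (\<i> * R) (- \<i> * R)) (\<lambda>w. q w * K w)"
      by (intro contour_integral_reverse_linepath continuous_intros holomorphic_on_imp_continuous_on 
          holomorphic_on_subset[OF q segT'] K)
    have line: "contour_integral (right_arc R) (\<lambda>w. q w * K w) = contour_integral (linepath (- \<i> * R) (\<i> * R)) (\<lambda>w. q w * K w)"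
      using s0 unfolding s1 eq_neg_iff_add_eq_0 .

    have "norm (contour_integral (right_arc R) (\<lambda>w. q w * K w - h N w * K w / w)) \<le> (2 * C / R\<^sup>2) * R * \<bar>pi/2 - (-pi/2)\<bar>"
    proof (rule contour_integral_bound_part_circlepath)
      show "(\<lambda>w. q w * K w - h N w * K w / w) contour_integrable_on (right_arc R)"
        by (intro contour_integrable_diff igr ihr)
      fix w assume w: "w \<in> path_image (right_arc R)"
      have nw: "norm w = R" and Rw: "Re w \<ge> 0" using right_arc_image[OF R w] .
      have "q w * K w - h N w * K w / w = (g w - h N w) * (K w / w)"
        using nz[OF nw] by (simp add: gq field_simps)
      also have "norm \<dots> \<le> 2 * C / R\<^sup>2"
      proof (cases "Re w = 0")
        case True
        then have "norm (K w / w) = 0" using normK[OF nw] by simp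
        then have "K w = 0" using nz[OF nw] by simp
        then show ?thesis using C by simp
      next
        case False
        then have pos: "Re w > 0" using Rw by simp
        have "norm ((g w - h N w) * (K w / w)) \<le> C * (real N powr (- Re w) / Re w) * (real N powr Re w * (2 * \<bar>Re w\<bar> / R\<^sup>2))"
          unfolding norm_mult normK[OF nw] by (intro mult_right_mono tail pos N) auto
        also have "\<dots> = 2 * C / R\<^sup>2 * (real N powr (- Re w) * real N powr Re w)" by (rule newman_bound_identities(1)[OF pos])
        also have "real N powr (- Re w) * real N powr Re w = 1" using N by (simp flip: powr_add)
        finally show ?thesis by simp
      qed
      finally show "norm (q w * K w - h N w * K w / w) \<le> 2 * C / R\<^sup>2" .
    qed (use C R in auto)
    also have "(2 * C / R\<^sup>2) * R * \<bar>pi/2 - (-pi/2)\<bar> = 2 * pi * (C / R)" 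
      using R by (simp add: power2_eq_square field_simps)
    finally have right: "norm (contour_integral (right_arc R) (\<lambda>w. q w * K w) - contour_integral (right_arc R) (\<lambda>w. h N w * K w / w)) \<le> 2 * pi * (C / R)"
      using contour_integral_diff[OF igr ihr] by simp

    have "norm (contour_integral (left_arc R) (\<lambda>w. h N w * K w / w)) \<le> (2 * C / R\<^sup>2 + 2 * C / (N * R)) * R * \<bar>3*pi/2 - pi/2\<bar>"
    proof (rule contour_integral_bound_part_circlepath[OF ihl])
      fix w assume w: "w \<in> path_image (left_arc R)"
      have nw: "norm w = R" and Rw: "Re w \<le> 0" using left_arc_image[OF R w] .
      show "norm (h N w * K w / w) \<le> 2 * C / R\<^sup>2 + 2 * C / (N * R)"
      proof (cases "Re w = 0")
        case True
        then have "norm (K w / w) = 0" using normK[OF nw] by simp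
        then have "K w = 0" using nz[OF nw] by simp
        then show ?thesis using C R by simp
      next
        case False
        then have pos: "Re w < 0" using Rw by simp
        have le: "- Re w \<le> R" using abs_Re_le_cmod[of w] nw by linarith
        have "norm (h N w * (K w / w)) \<le> C * (real N powr (- Re w) / (- Re w) + real N powr (- Re w - 1)) * (real N powr Re w * (2 * \<bar>Re w\<bar> / R\<^sup>2))"
          unfolding norm_mult normK[OF nw] by (intro mult_right_mono partial pos) auto
        also have "real N powr (- Re w - 1) = real N powr (- Re w) / N" using N by (simp add: powr_diff)
        also have "C * (real N powr (- Re w) / (- Re w) + real N powr (- Re w) / N) * (real N powr Re w * (2 * \<bar>Re w\<bar> / R\<^sup>2))
            = (real N powr (- Re w) * real N powr Re w) * (2 * C / R\<^sup>2 + 2 * C / N * (- Re w) / R\<^sup>2)" 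
          by (rule newman_bound_identities(2)[OF pos])
        also have "real N powr (- Re w) * real N powr Re w = 1" using N by (simp flip: powr_add)
        also have "1 * (2 * C / R\<^sup>2 + 2 * C / N * (- Re w) / R\<^sup>2) = 2 * C / R\<^sup>2 + 2 * C / N * (- Re w) / R\<^sup>2"
          by (rule mult_1)
        also have "\<dots> \<le> 2 * C / R\<^sup>2 + 2 * C / N * R / R\<^sup>2"
          by (intro add_left_mono divide_right_mono mult_left_mono le) (use C in auto)
        also have "2 * C / N * R / R\<^sup>2 = 2 * C / (N * R)" using R by (rule newman_bound_identities(3))
        finally show ?thesis unfolding times_divide_eq_right .
      qed
    qed (use C R in auto)
    also have "(2 * C / R\<^sup>2 + 2 * C / (N * R)) * R * \<bar>3*pi/2 - pi/2\<bar> = 2 * pi * (C / R + C / N)"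
      using R by (rule newman_bound_identities(4))
    finally have left: "norm (contour_integral (left_arc R) (\<lambda>w. h N w * K w / w)) \<le> 2 * pi * (C / R + C / N)" .

    define J where "J = contour_integral (linepath (- \<i> * R) (\<i> * R)) (\<lambda>w. q w * K w)"
    have "2 * pi * \<i> * h N 0 = J - (contour_integral (right_arc R) (\<lambda>w. q w * K w) - contour_integral (right_arc R) (\<lambda>w. h N w * K w / w)) 
             + contour_integral (left_arc R) (\<lambda>w. h N w * K w / w)"
      unfolding cauchy[symmetric] line J_def by simp
    also have "norm \<dots> \<le> norm J + 2 * pi * (C / R) + 2 * pi * (C / R + C / N)"
      by (intro order_trans[OF norm_triangle_ineq] order_trans[OF norm_triangle_ineq4] add_mono right left order_refl)
    finally have "norm (2 * pi * \<i> * h N 0) \<le> norm J + 2 * pi * (C / R) + 2 * pi * (C / R + C / N)" .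
    then have "2 * pi * norm (h N 0) \<le> norm J + 2 * pi * (2 * C / R + C / N)"
      by (simp add: norm_mult algebra_simps)
    also have "\<dots> \<le> 2 * pi * norm J + 2 * pi * (2 * C / R + C / N)"
      using pi_ge_two mult_right_mono[of 1 "2 * pi" "norm J"] by simp
    finally have "2 * pi * norm (h N 0) \<le> 2 * pi * (norm J + (2 * C / R + C / N))"
      by (simp add: algebra_simps)
    then have "norm (h N 0) \<le> norm J + (2 * C / R + C / N)" by simp
    then show ?thesis by (simp add: J_def K_def mult_ac)
  qed

  have "(\<lambda>N. h N 0) \<longlonglongrightarrow> 0"
  proof (rule tendstoI)
    fix e :: real assume e: "e > 0"
    define D where "D = C + 1"
    have D: "D > 0" "C / D < 1" using C by (simp_all add: D_def)
    \<comment> \<open>This choice makes the part 2 C / R of the error, which does not depend on N, smaller than e.\<close>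
    define R where "R = 2 * D / e"
    have R: "R > 0" using e D by (simp add: R_def)
    have "2 * C / R = e * (C / D)" using e D by (simp add: R_def)
    also have "\<dots> < e * 1" using e D by (intro mult_strict_left_mono) auto
    finally have R_bound: "2 * C / R < e" by simp
    define u where "u = (\<lambda>w. q w * (1 + w\<^sup>2 / R\<^sup>2))"
    have "(\<lambda>N. contour_integral (linepath (- \<i> * R) (\<i> * R)) (\<lambda>w. u w * of_nat N powr w)) \<longlonglongrightarrow> 0"
    proof (rule linepath_oscillating_integral_tendsto_0)
      show "u holomorphic_on T" unfolding u_def using R by (intro holomorphic_intros q) auto
      have "closed_segment (- \<i> * R) (\<i> * R) \<subseteq> {w. Re w \<ge> 0}" by (auto simp: in_segment)
      then show "closed_segment (- \<i> * R) (\<i> * R) \<subseteq> T" using Re_T by blast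
      show "u (- \<i> * R) = 0" "u (\<i> * R) = 0" using R by (simp_all add: u_def power_mult_distrib)
    qed (simp_all add: T)
    then have "(\<lambda>N. norm (contour_integral (linepath (- \<i> * R) (\<i> * R)) (\<lambda>w. u w * of_nat N powr w)) + 2 * C / R + C / N) \<longlonglongrightarrow> norm (0::complex) + 2 * C / R + 0"
      by (intro tendsto_add[OF tendsto_add[OF tendsto_norm tendsto_const] lim_const_over_n])
    then have "eventually (\<lambda>N. norm (contour_integral (linepath (- \<i> * R) (\<i> * R)) (\<lambda>w. u w * of_nat N powr w)) + 2 * C / R + C / N < e) sequentially"
      by (rule order_tendstoD) (use R_bound in simp)
    then show "eventually (\<lambda>N. dist (h N 0) 0 < e) sequentially"
      using eventually_gt_at_top[of 0]
    proof eventually_elim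
      case (elim N)
      then show ?case using main[OF R, of N] by (simp add: u_def)
    qed
  qed
  moreover have "h N 0 = (\<Sum>n\<le>N. a n / of_nat n)" for N
    unfolding h_def by (intro sum.cong) (auto simp: powr_minus field_simps)
  ultimately show ?thesis by simp
qed

text \<open>
  Subtracting f 1 from the coefficient of n = 1 changes the sum of the series by the constant f 1 and so reduces
  the claim to the case of a sum vanishing at 1.
\<close>
theorem newman_tauberian:
  fixes a :: "nat \<Rightarrow> complex"
  assumes a: "\<And>n. norm (a n) \<le> C" 
    and S: "open S" "{s. Re s \<ge> 1} \<subseteq> S" and f: "f holomorphic_on S"
    and sums: "\<And>s. Re s > 1 \<Longrightarrow> (\<lambda>n. a n * of_nat n powr (- s)) sums f s"
  shows "(\<lambda>n. a n / of_nat n) sums f 1"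
proof -
  define b where "b = (\<lambda>n. a n - (if n = 1 then f 1 else 0))"
  have "(\<lambda>N. \<Sum>n\<le>N. b n / of_nat n) \<longlonglongrightarrow> 0"
  proof (rule newman_tauberian_vanishing[OF _ S])
    show "norm (b n) \<le> C + norm (f 1)" for n
      using add_mono[OF a[of n] norm_ge_zero[of "f 1"]] norm_triangle_ineq4[of "a n" "f 1"] a[of n] 
      by (auto simp: b_def simp del: norm_ge_zero)
    show "(\<lambda>s. f s - f 1) holomorphic_on S" by (intro holomorphic_intros f)
    fix s :: complex assume s: "Re s > 1"
    have "(\<lambda>n. a n * of_nat n powr (- s) - (if n = 1 then f 1 else 0)) sums (f s - f 1)"
      using sums[OF s] by (rule sums_diff) (use sums_single[of 1 "\<lambda>_. f 1"] in simp)
    also have "(\<lambda>n. a n * of_nat n powr (- s) - (if n = 1 then f 1 else 0)) = (\<lambda>n. b n * of_nat n powr (- s))"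
      by (auto simp: b_def)
    finally show "(\<lambda>n. b n * of_nat n powr (- s)) sums (f s - f 1)" .
  qed auto
  then have "(\<lambda>n. b n / of_nat n) sums 0" by (simp add: sums_def_le)
  then have "(\<lambda>n. b n / of_nat n + (if n = 1 then f 1 else 0)) sums (0 + f 1)"
    by (rule sums_add) (use sums_single[of 1 "\<lambda>_. f 1"] in simp)
  also have "(\<lambda>n. b n / of_nat n + (if n = 1 then f 1 else 0)) = (\<lambda>n. a n / of_nat n)"
    by (auto simp: b_def diff_divide_distrib)
  finally show ?thesis by simp
qed

section \<open>The prime number theorem\<close>

definition psi :: "nat \<Rightarrow> real" where "psi n = (\<Sum>d\<le>n. mangoldt d)"

lemma psi_Suc: "psi (Suc n) = psi n + mangoldt (Suc n)" by (simp add: psi_def)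

lemma incseq_psi: "incseq psi"
  by (rule incseq_SucI) (simp add: psi_Suc mangoldt_nonneg)

text \<open>
  The bound N of the summation is independent of n so that the formulas for n and for 2 n can be combined in one sum.
\<close>
lemma ln_fact_eq_sum_mangoldt:
  assumes "n \<le> N"
  shows "ln (fact n) = (\<Sum>d\<in>{1..N}. mangoldt d * real (n div d))"
  using assms
proof (induction n)
  case (Suc n)
  have "(\<Sum>d\<in>{1..N}. mangoldt d * real (Suc n div d)) 
          = (\<Sum>d\<in>{1..N}. mangoldt d * real (n div d) + (if d dvd Suc n then mangoldt d else 0))"
    by (intro sum.cong refl) (auto simp: div_Suc dvd_eq_mod_eq_0 algebra_simps)
  also have "\<dots> = ln (fact n) + (\<Sum>d\<in>{1..N} \<inter> {d. d dvd Suc n}. mangoldt d)"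
    using Suc by (simp add: sum.distrib sum.inter_restrict)
  also have "{1..N} \<inter> {d. d dvd Suc n} = {d. d dvd Suc n}"
    using Suc.prems by (auto intro!: Suc_leI Nat.gr0I intro: order_trans[OF dvd_imp_le])
  also have "(\<Sum>d | d dvd Suc n. mangoldt d) = ln (real (Suc n))"
    using mangoldt_sum[of "Suc n", where ?'a = real] by simp
  also have "ln (fact n) + ln (real (Suc n)) = ln (fact (Suc n))"
    by (simp add: ln_mult)
  finally show ?case ..
qed auto

text \<open>
  The factor \<lfloor>2n/d\<rfloor> - 2 \<lfloor>n/d\<rfloor> is never negative and equals 1 for n < d \<le> 2n, so the left side is at most
  the logarithm of the central binomial coefficient.
\<close>
lemma psi_double_le: "psi (2 * n) - psi n \<le> 2 * n * ln 2"
proof -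
  have "{..2*n} = {..n} \<union> {n<..2*n}" by auto
  then have "psi (2 * n) - psi n = (\<Sum>d\<in>{n<..2*n}. mangoldt d)"
    unfolding psi_def by (simp only:) (subst sum.union_disjoint, auto)
  also have "\<dots> = (\<Sum>d\<in>{n<..2*n}. mangoldt d * (real (2 * n div d) - 2 * real (n div d)))"
  proof (intro sum.cong refl)
    fix d assume d: "d \<in> {n<..2*n}"
    then have "2 * n div d = 1" by (intro div_nat_eqI) auto
    moreover have "n div d = 0" using d by simp
    ultimately show "mangoldt d = mangoldt d * (real (2 * n div d) - 2 * real (n div d))" by simp
  qed
  also have "\<dots> \<le> (\<Sum>d\<in>{1..2*n}. mangoldt d * (real (2 * n div d) - 2 * real (n div d)))"
  proof (rule sum_mono2)
    fix d assume "d \<in> {1..2*n} - {n<..2*n}"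
    then have "d > 0" by auto
    then have "2 * (n div d) \<le> 2 * n div d"
      using div_times_less_eq_dividend[of n d] by (simp add: less_eq_div_iff_mult_less_eq)
    then have "2 * real (n div d) \<le> real (2 * n div d)" by linarith
    then show "0 \<le> mangoldt d * (real (2 * n div d) - 2 * real (n div d))"
      by (intro mult_nonneg_nonneg mangoldt_nonneg) auto
  qed auto
  also have "\<dots> = ln (fact (2 * n)) - 2 * ln (fact n)"
    by (simp add: ln_fact_eq_sum_mangoldt[of _ "2 * n"] right_diff_distrib sum_subtractf sum_distrib_left mult_ac)
  also have "\<dots> = ln (real ((2 * n) choose n))"
    by (simp add: binomial_fact ln_div ln_mult)
  also have "\<dots> \<le> ln (2 ^ (2 * n))"
  proof (subst ln_le_cancel_iff)
    have "real ((2 * n) choose n) \<le> real (2 ^ (2 * n))" by (subst of_nat_le_iff) (rule binomial_le_pow2)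
    then show "real ((2 * n) choose n) \<le> 2 ^ (2 * n)" by simp
  qed auto
  also have "\<dots> = 2 * real n * ln 2" by (simp add: ln_realpow)
  finally show ?thesis .
qed

text \<open>
  Doubling steps give a geometric sum at powers of 2. Going from n to the next power of 2 loses another factor of 2.
\<close>
lemma psi_le: "psi n \<le> 4 * ln 2 * real n"
proof (cases "n = 0")
  case False
  have pow: "psi (2 ^ k) \<le> 2 * ln 2 * 2 ^ k" for k
  proof (induction k)
    case 0
    have "psi 1 = 0" by (simp add: psi_def)
    then show ?case by simp
  next
    case (Suc k)
    then show ?case using psi_double_le[of "2 ^ k"] by (simp add: algebra_simps)
  qed
  obtain k where k: "2 ^ k \<le> n" "n < 2 ^ (k + 1)"
    using ex_power_ivl1[of 2 n] False by auto
  have "psi n \<le> psi (2 ^ (k + 1))" using k(2) by (intro incseqD[OF incseq_psi]) auto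
  also have "\<dots> \<le> 2 * ln 2 * 2 ^ (k + 1)" by (rule pow)
  also have "\<dots> = 4 * ln 2 * real (2 ^ k)" by simp
  also have "\<dots> \<le> 4 * ln 2 * real n" using k(1) by (intro mult_left_mono, subst of_nat_le_iff) auto
  finally show ?thesis .
qed (simp add: psi_def)

lemma psi_nonneg: "psi n \<ge> 0" unfolding psi_def by (intro sum_nonneg mangoldt_nonneg)

lemma abs_psi_minus_le: "\<bar>psi n - real n\<bar> \<le> (4 * ln 2 + 1) * real n"
proof -
  have "psi n - real n \<le> (4 * ln 2 + 1) * real n" using psi_le[of n] by (simp add: algebra_simps)
  moreover have "- (psi n - real n) \<le> (4 * ln 2 + 1) * real n"
    using psi_nonneg[of n] by (simp add: algebra_simps)
  ultimately show ?thesis by linarith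
qed

text \<open>
  Summation by parts. The boundary term (\<psi>(N) - N) N^(-s) vanishes in the limit by Chebyshev's estimate.
\<close>
lemma psi_partial_summation:
  assumes s: "Re s > 1"
  shows "(\<lambda>n. of_real (psi n - n) * (of_nat n powr (- s) - of_nat (Suc n) powr (- s))) sums (mangoldt_series s - zeta s)"
proof -
  have eq: "(\<Sum>n<N. of_real (psi n - n) * (of_nat n powr (- s) - of_nat (Suc n) powr (- s)))
          = (\<Sum>n\<le>N. mangoldt n * of_nat n powr (- s) - of_nat n powr (- s)) - of_real (psi N - N) * of_nat N powr (- s)" for N
    by (induction N) (simp_all add: psi_Suc algebra_simps)
  have 1: "(\<lambda>N. \<Sum>n\<le>N. mangoldt n * of_nat n powr (- s) - of_nat n powr (- s)) \<longlonglongrightarrow> mangoldt_series s - zeta s"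
    using sums_diff[OF mangoldt_series(1)[OF s] zeta_sums(1)[OF s]] by (simp add: sums_def_le)
  have 2: "(\<lambda>N. of_real (psi N - N) * of_nat N powr (- s) :: complex) \<longlonglongrightarrow> 0"
  proof (rule Lim_null_comparison)
    show "\<forall>\<^sub>F N in sequentially. norm (of_real (psi N - N) * of_nat N powr (- s) :: complex) \<le> (4 * ln 2 + 1) * real N * real N powr (- Re s)"
      using eventually_gt_at_top[of 0]
    proof eventually_elim
      case (elim N)
      have "norm (of_real (psi N - N) * of_nat N powr (- s) :: complex) = \<bar>psi N - N\<bar> * real N powr (- Re s)"
        using elim by (simp only: norm_mult norm_of_nat_powr norm_of_real) simp
      also have "\<dots> \<le> (4 * ln 2 + 1) * real N * real N powr (- Re s)"
        by (intro mult_right_mono abs_psi_minus_le) auto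
      finally show ?case .
    qed
    show "(\<lambda>N. (4 * ln 2 + 1) * real N * real N powr (- Re s)) \<longlonglongrightarrow> 0"
      using s by real_asymp
  qed
  show ?thesis unfolding sums_def eq using tendsto_diff[OF 1 2] by simp
qed

text \<open>
  The coefficients n^(-s) - (n+1)^(-s) of the previous lemma differ from s n^(-s-1) by the Taylor error
  \<open>zeta_term n (s + 1)\<close>. Hence the Dirichlet series of \<psi>(n)/n - 1 differs from
  (-\<zeta>'(s)/\<zeta>(s) - \<zeta>(s))/s by P(s + 1)/s with P holomorphic for Re s > 1. In terms of Z = (s - 1) \<zeta>, the function
  -\<zeta>'/\<zeta> - \<zeta> is -Z'/Z - (Z - 1)/(s - 1), and the last quotient is holomorphic because Z(1) = 1.
\<close>
lemma summable_psi: "summable (\<lambda>n. (psi n / n - 1) / n)"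
proof -
  define C where "C = 4 * ln 2 + (1::real)"
  define Q where "Q = (\<lambda>s. if s = 1 then deriv zeta_reg 1 else (zeta_reg s - zeta_reg 1) / (s - 1))"
  have S0: "open {s. Re s > 0}" by (rule open_halfspace_Re_gt)
  have Q: "Q holomorphic_on {s. Re s > 0}"
    unfolding Q_def by (rule pole_lemma_open[OF zeta_reg_holomorphic S0])
  have c: "norm (of_real (psi n - n) :: complex) \<le> C * real n powr 1" for n
    using abs_psi_minus_le[of n] unfolding norm_of_real C_def by simp
  obtain P where P: "P holomorphic_on {s. Re s > 1}" 
     "\<And>s. Re s > 1 \<Longrightarrow> (\<lambda>n. of_real (psi n - n) * zeta_term n s) sums P s"
    using zeta_term_series_holomorphic[OF c] by auto
  have P': "(\<lambda>s. P (s + 1)) holomorphic_on {s. Re s > 0}"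
    by (rule holomorphic_on_compose_gen[OF _ P(1), of "\<lambda>s. s + 1", unfolded o_def]) (auto intro!: holomorphic_intros)
  define S where "S = {s. Re s > 0} \<inter> zeta_reg -` (- {0})"
  define f where "f = (\<lambda>s. (- (deriv zeta_reg s / zeta_reg s) - Q s + P (s + 1)) / s)"
  have "(\<lambda>n. of_real (psi n / n - 1) / of_nat n) sums f 1"
  proof (rule newman_tauberian)
    show "norm (of_real (psi n / n - 1) :: complex) \<le> C" for n
    proof (cases "n = 0")
      case False
      then have "psi n / n - 1 = (psi n - n) / n" by (simp add: diff_divide_distrib)
      then have "\<bar>psi n / n - 1\<bar> = \<bar>psi n - n\<bar> / n" by (simp only: abs_divide abs_of_nat)
      also have "\<dots> \<le> C" using False abs_psi_minus_le[of n] by (simp add: C_def field_simps)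
      finally show ?thesis by (simp only: norm_of_real)
    qed (simp add: C_def)
    show "open S"
      unfolding S_def by (intro continuous_open_preimage S0 holomorphic_on_imp_continuous_on zeta_reg_holomorphic) auto
    show "{s. Re s \<ge> 1} \<subseteq> S"
      using zeta_reg_nonzero by (auto simp: S_def)
    have sub: "S \<subseteq> {s. Re s > 0}" by (auto simp: S_def)
    have dz: "deriv zeta_reg holomorphic_on S"
      by (rule holomorphic_on_subset[OF holomorphic_deriv[OF zeta_reg_holomorphic S0] sub])
    have "0 \<notin> S" by (auto simp: S_def)
    then show "f holomorphic_on S"
      unfolding f_def
      by (intro holomorphic_on_divide holomorphic_on_add holomorphic_on_diff holomorphic_on_minus dz 
         holomorphic_on_subset[OF Q sub] holomorphic_on_subset[OF P' sub] 
         holomorphic_on_subset[OF zeta_reg_holomorphic sub] holomorphic_on_ident) (auto simp: S_def)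
    fix s :: complex assume s: "Re s > 1"
    then have s0: "s \<noteq> 0" "s \<noteq> 1" by auto
    have t: "of_real (psi n - n) * zeta_term n (s + 1) + of_real (psi n - n) * (of_nat n powr (- s) - of_nat (Suc n) powr (- s)) 
             = s * (of_real (psi n / n - 1) * of_nat n powr (- s))" for n
    proof (cases "n = 0")
      case False
      have p: "(of_nat n :: complex) powr (- (s + 1)) = of_nat n powr (- s) / of_nat n"
        using False by (simp add: powr_diff)
      have "of_real (psi n - n) * zeta_term n (s + 1) + of_real (psi n - n) * (of_nat n powr (- s) - of_nat (Suc n) powr (- s))
              = of_real (psi n - n) * (s * of_nat n powr (- (s + 1)))"
        by (simp add: zeta_term_def algebra_simps del: of_nat_Suc)
      also have "\<dots> = s * (of_real (psi n - n) / of_nat n * of_nat n powr (- s))"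
        unfolding p by simp
      also have "of_real (psi n - n) / of_nat n = (of_real (psi n / n - 1) :: complex)"
        using False by (simp add: field_simps)
      finally show ?thesis .
    qed (simp add: psi_def)
    have "(\<lambda>n. of_real (psi n - n) * zeta_term n (s + 1) + of_real (psi n - n) * (of_nat n powr (- s) - of_nat (Suc n) powr (- s))) 
            sums (P (s + 1) + (mangoldt_series s - zeta s))"
      by (intro sums_add P psi_partial_summation) (use s in auto)
    then have "(\<lambda>n. s * (of_real (psi n / n - 1) * of_nat n powr (- s))) sums (P (s + 1) + (mangoldt_series s - zeta s))"
      unfolding t .
    from sums_divide[OF this, of s] 
    have *: "(\<lambda>n. of_real (psi n / n - 1) * of_nat n powr (- s)) sums ((P (s + 1) + (mangoldt_series s - zeta s)) / s)"
      using s0 by simp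
    have "zeta s = zeta_reg s / (s - 1)" using zeta_reg_eq[OF s] s0 by simp
    then have "mangoldt_series s - zeta s = - (deriv zeta_reg s / zeta_reg s) - Q s"
      unfolding mangoldt_series_eq[OF s] Q_def using s0 by (simp add: zeta_reg_1 diff_divide_distrib)
    then have "(P (s + 1) + (mangoldt_series s - zeta s)) / s = f s" by (simp add: f_def)
    with * show "(\<lambda>n. of_real (psi n / n - 1) * of_nat n powr (- s)) sums f s" by simp
  qed
  from sums_Re[OF this] have "(\<lambda>n. (psi n / n - 1) / n) sums Re (f 1)" by (simp add: Re_divide_of_nat)
  then show ?thesis by (rule sums_summable)
qed

text \<open>
  If f N \<ge> (1 + e) N, then monotonicity keeps f n - n above e N / 2 for N \<le> n \<le> (1 + e/2) N, so that block of the
  series contributes, for large N, at least a positive constant depending only on e. By convergence this happens for finitely many N only.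
  If f N \<le> (1 - e) N, the same argument applies to the block just below N.
\<close>
lemma incseq_tendsto_1_of_summable:
  fixes f :: "nat \<Rightarrow> real"
  assumes f: "incseq f" and summable: "summable (\<lambda>n. (f n / n - 1) / n)"
  shows "(\<lambda>n. f n / n) \<longlonglongrightarrow> 1"
proof -
  have cauchy: "\<exists>N0. \<forall>m\<ge>N0. \<forall>n. \<bar>\<Sum>k=m..<n. (f k / k - 1) / k\<bar> < \<eta>" if "\<eta> > 0" for \<eta> :: real
    using summable that unfolding summable_Cauchy by auto
  have upper: "eventually (\<lambda>N. f N / N < 1 + e) sequentially" if e: "e > 0" for e :: real
  proof -
    define \<eta> where "\<eta> = e / 4 * (e / 2 / (1 + e / 2)\<^sup>2)"
    have "\<eta> > 0" using e by (simp add: \<eta>_def)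
    then obtain N0 where N0: "\<And>m n. m \<ge> N0 \<Longrightarrow> \<bar>\<Sum>k=m..<n. (f k / k - 1) / k\<bar> < \<eta>"
      using cauchy by blast
    have "eventually (\<lambda>N. N \<ge> N0 \<and> real N \<ge> 4 / e \<and> N > 0) sequentially"
      by (intro eventually_conj eventually_ge_at_top eventually_gt_at_top
           filterlim_real_sequentially[unfolded filterlim_at_top, rule_format])
    then show ?thesis
    proof eventually_elim
      case (elim N)
      show ?case
      proof (rule ccontr)
        assume "\<not> f N / N < 1 + e"
        then have fN: "f N \<ge> (1 + e) * N" using elim by (simp add: field_simps)
        \<comment> \<open>The length of the block. For N \<ge> 4/e, rounding down costs at most half of it.\<close>
        define k where "k = nat \<lfloor>e * N / 2\<rfloor>"
        have "real k = of_int \<lfloor>e * N / 2\<rfloor>" using e by (simp add: k_def)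
        then have k: "real k \<le> e * N / 2" "real k \<ge> e * N / 2 - 1"
          by linarith+
        have "1 \<le> e * N / 4" using elim e by (simp add: field_simps)
        then have k': "real k \<ge> e * N / 4" using k by simp
        have "\<eta> = (e * N / 4) * ((e / 2 / (1 + e / 2)\<^sup>2) / N)" using elim by (simp add: \<eta>_def)
        also have "\<dots> \<le> k * ((e / 2 / (1 + e / 2)\<^sup>2) / N)"
          by (intro mult_right_mono k') (use e in auto)
        also have "\<dots> = (\<Sum>n=N..<N+k. (e / 2 / (1 + e / 2)\<^sup>2) / N)" by simp
        also have "\<dots> \<le> (\<Sum>n=N..<N+k. (f n / n - 1) / n)"
        proof (rule sum_mono)
          fix n assume n: "n \<in> {N..<N+k}"
          then have "real n \<le> real N + real k" by simp
          then have n1: "real n \<le> (1 + e / 2) * N" using k(1) by (simp add: algebra_simps)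
          have n0: "real n > 0" using n elim by auto
          have "f n \<ge> f N" using n by (intro incseqD[OF f]) auto
          then have fn: "f n - n \<ge> e / 2 * N" using fN n1 by (simp add: algebra_simps)
          moreover have "0 \<le> e / 2 * N" using e by simp
          ultimately have fn0: "0 \<le> f n - n" by linarith
          have "(e / 2 / (1 + e / 2)\<^sup>2) / N = (e / 2 * N) / ((1 + e / 2) * N)\<^sup>2"
            using elim by (simp add: power_mult_distrib power2_eq_square)
          also have "\<dots> \<le> (f n - n) / (real n)\<^sup>2"
            using n1 n0 by (intro frac_le power_mono fn fn0) auto
          also have "\<dots> = (f n / n - 1) / n" using n0 by (simp add: power2_eq_square field_simps)
          finally show "(e / 2 / (1 + e / 2)\<^sup>2) / N \<le> (f n / n - 1) / n" .
        qed
        finally show False using N0[of N "N + k"] elim by linarith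
      qed
    qed
  qed
  have lower: "eventually (\<lambda>N. f N / N > 1 - e) sequentially" if e: "e > 0" "e < 1" for e :: real
  proof -
    define \<eta> where "\<eta> = e / 4 * (e / 2)"
    have "\<eta> > 0" using e by (simp add: \<eta>_def)
    then obtain N0 where N0: "\<And>m n. m \<ge> N0 \<Longrightarrow> \<bar>\<Sum>k=m..<n. (f k / k - 1) / k\<bar> < \<eta>"
      using cauchy by blast
    have "eventually (\<lambda>N. N \<ge> 2 * N0 \<and> real N \<ge> 4 / e \<and> N > 0) sequentially"
      by (intro eventually_conj eventually_ge_at_top eventually_gt_at_top
           filterlim_real_sequentially[unfolded filterlim_at_top, rule_format])
    then show ?thesis
    proof eventually_elim
      case (elim N)
      show ?case
      proof (rule ccontr)
        assume "\<not> f N / N > 1 - e"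
        then have fN: "f N \<le> (1 - e) * N" using elim by (simp add: field_simps)
        define k where "k = nat \<lfloor>e * N / 2\<rfloor>"
        have "real k = of_int \<lfloor>e * N / 2\<rfloor>" using e by (simp add: k_def)
        then have k: "real k \<le> e * N / 2" "real k \<ge> e * N / 2 - 1"
          by linarith+
        have "1 \<le> e * N / 4" using elim e by (simp add: field_simps)
        then have k': "real k \<ge> e * N / 4" using k by simp
        have "e * N / 2 \<le> N / 2" using e by (simp add: mult_left_le_one_le)
        then have kN: "2 * k \<le> N" using k(1) by linarith
        have kN': "N - k \<ge> N0" "real (N - k) = real N - real k" using kN elim by auto
        have "\<eta> = (e * N / 4) * (e / 2 / N)" using elim by (simp add: \<eta>_def)
        also have "\<dots> \<le> k * (e / 2 / N)"
          by (intro mult_right_mono k') (use e in auto)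
        also have "\<dots> = (\<Sum>n=N-k..<N. e / 2 / N)" using kN by simp
        also have "\<dots> \<le> (\<Sum>n=N-k..<N. - ((f n / n - 1) / n))"
        proof (rule sum_mono)
          fix n assume n: "n \<in> {N-k..<N}"
          then have "real n \<ge> real N - real k" using kN'(2) by (metis atLeastLessThan_iff of_nat_le_iff)
          then have n1: "real n \<ge> (1 - e / 2) * N" using k(1) by (simp add: algebra_simps)
          have n0: "real n > 0" using n kN elim by auto
          have "f n \<le> f N" using n by (intro incseqD[OF f]) auto
          then have fn: "n - f n \<ge> e / 2 * N" using fN n1 by (simp add: algebra_simps)
          moreover have "0 \<le> e / 2 * N" using e by simp
          ultimately have fn0: "0 \<le> n - f n" by linarith
          have "e / 2 / N = (e / 2 * N) / (real N)\<^sup>2"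
            using elim by (simp add: power2_eq_square)
          also have "\<dots> \<le> (n - f n) / (real n)\<^sup>2"
            using n n0 by (intro frac_le power_mono fn fn0) auto
          also have "\<dots> = - ((f n / n - 1) / n)" using n0 by (simp add: power2_eq_square field_simps)
          finally show "e / 2 / N \<le> - ((f n / n - 1) / n)" .
        qed
        also have "\<dots> = - (\<Sum>n=N-k..<N. (f n / n - 1) / n)" by (simp add: sum_negf)
        finally show False using N0[of "N - k" N] kN' by linarith
      qed
    qed
  qed
  show ?thesis
  proof (rule order_tendstoI)
    fix a :: real assume "a > 1"
    then show "eventually (\<lambda>N. f N / N < a) sequentially" using upper[of "a - 1"] by simp
  next
    fix a :: real assume a: "a < 1"
    have "eventually (\<lambda>N. f N / N > 1 - min (1 - a) (1/2)) sequentially" using a by (intro lower) auto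
    then show "eventually (\<lambda>N. f N / N > a) sequentially" 
      by eventually_elim (use min.cobounded1[of "1 - a" "1/2"] in linarith)
  qed
qed

theorem prime_number_theorem_psi: "(\<lambda>n. psi n / n) \<longlonglongrightarrow> 1"
  by (rule incseq_tendsto_1_of_summable[OF incseq_psi summable_psi])

section \<open>The least common multiple of an interval\<close>

lemma primepow_dvd_lcm:
  fixes a b :: nat
  assumes "primepow q" "q dvd lcm a b"
  shows "q dvd a \<or> q dvd b"
proof (cases "a = 0 \<or> b = 0")
  case False
  from assms(1) obtain p k where q: "prime p" "q = p ^ k" by (auto simp: primepow_def)
  have np: "\<not> is_unit p" using q(1) by (auto simp: prime_nat_iff)
  have "k \<le> multiplicity p (lcm a b)"
    using assms(2) False np q by (subst power_dvd_iff_le_multiplicity[symmetric]) (auto simp: lcm_eq_0_iff)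
  also have "\<dots> = max (multiplicity p a) (multiplicity p b)"
    using False q(1) by (intro multiplicity_lcm) auto
  finally show ?thesis
    using False np q by (auto simp: power_dvd_iff_le_multiplicity max_def split: if_splits)
qed auto

lemma primepow_dvd_Lcm:
  fixes A :: "nat set"
  assumes "finite A" "primepow q" "q dvd Lcm A"
  shows "\<exists>a\<in>A. q dvd a"
  using assms(1,3)
proof (induction A rule: finite_induct)
  case empty
  then show ?case using primepow_gt_Suc_0[OF assms(2)] by simp
next
  case (insert a A)
  then show ?case using primepow_dvd_lcm[OF assms(2), of a "Lcm A"] by auto
qed

text \<open>
  The sum of \<Lambda> over the divisors of the lcm is its logarithm, and only prime powers contribute to it.
\<close>
lemma ln_Lcm_eq_sum_mangoldt:
  fixes A :: "nat set"
  assumes A: "finite A" "0 \<notin> A"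
  shows "ln (real (Lcm A)) = (\<Sum>d | \<exists>a\<in>A. d dvd a. mangoldt d)"
proof -
  have "Lcm A \<noteq> 0" using A by (simp add: Lcm_0_iff)
  then have "ln (real (Lcm A)) = (\<Sum>d | d dvd Lcm A. mangoldt d)"
    using mangoldt_sum[of "Lcm A", where ?'a = real] by simp
  also have "\<dots> = (\<Sum>d | \<exists>a\<in>A. d dvd a. mangoldt d)"
  proof (rule sum.mono_neutral_right)
    show "finite {d. d dvd Lcm A}" using \<open>Lcm A \<noteq> 0\<close> by simp
    show "{d. \<exists>a\<in>A. d dvd a} \<subseteq> {d. d dvd Lcm A}" by (auto intro: dvd_trans dvd_Lcm)
    show "\<forall>d\<in>{d. d dvd Lcm A} - {d. \<exists>a\<in>A. d dvd a}. mangoldt d = (0::real)"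
      using primepow_dvd_Lcm[OF A(1)] by (auto simp: mangoldt_def)
  qed
  finally show ?thesis .
qed

text \<open>
  The number d has a multiple d k in (mn, ln] exactly if d lies in (mn/k, ln/k]. For k > K this puts d below ln/(K+1).
  Conversely, every positive d \<le> ln/(K+1) has such a multiple. If d is at most the length (l - m) n of the
  interval, its largest multiple up to ln lies in it. Otherwise d (K + 1) does, since (K + 1)(l - m) > m.
\<close>
lemma divisors_of_interval:
  fixes l m n K :: nat
  assumes lm: "m < l" and K: "K = m div (l - m)"
  shows "{d. \<exists>i\<in>{m * n<..l * n}. d dvd i} = (\<Union>k\<in>{1..K}. {m * n div k<..l * n div k}) \<union> {1..l * n div (K + 1)}"
proof (intro equalityI subsetI)
  fix d assume "d \<in> {d. \<exists>i\<in>{m * n<..l * n}. d dvd i}"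
  then obtain i where i: "m * n < i" "i \<le> l * n" "d dvd i" by auto
  from i(3) obtain k where "i = d * k" ..
  with i have k: "m * n < d * k" "d * k \<le> l * n" by simp_all
  then have pos: "d > 0" "k > 0" by (auto intro!: Nat.gr0I)
  show "d \<in> (\<Union>k\<in>{1..K}. {m * n div k<..l * n div k}) \<union> {1..l * n div (K + 1)}"
  proof (cases "k \<le> K")
    case True
    have "m * n div k < d" "d \<le> l * n div k"
      using k pos by (simp_all add: div_less_iff_less_mult less_eq_div_iff_mult_less_eq mult.commute)
    then show ?thesis using True pos by auto
  next
    case False
    then have "d * (K + 1) \<le> d * k" by (intro mult_le_mono) auto
    then have "d \<le> l * n div (K + 1)" using k by (subst less_eq_div_iff_mult_less_eq) auto
    then show ?thesis using pos by auto
  qed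
next
  fix d assume d: "d \<in> (\<Union>k\<in>{1..K}. {m * n div k<..l * n div k}) \<union> {1..l * n div (K + 1)}"
  have "\<exists>k. m * n < d * k \<and> d * k \<le> l * n"
  proof (cases "d \<in> {1..l * n div (K + 1)}")
    case False
    then obtain k where "k \<in> {1..K}" "d \<in> {m * n div k<..l * n div k}" using d by blast
    then have k: "k > 0" "m * n div k < d" "d \<le> l * n div k" by auto
    then show ?thesis
      by (intro exI[of _ k]) (simp_all add: div_less_iff_less_mult less_eq_div_iff_mult_less_eq mult.commute)
  next
    case True
    then have pos: "d > 0" by auto
    have dK: "d * (K + 1) \<le> l * n" using True by (subst less_eq_div_iff_mult_less_eq[symmetric]) auto
    show ?thesis
    proof (cases "d \<le> (l - m) * n")
      case True
      have "l * n < d * (l * n div d) + d" using pos by (metis dividend_less_times_div add.commute mult.commute)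
      moreover have "(l - m) * n + m * n = l * n" using lm by (simp flip: add_mult_distrib)
      ultimately show ?thesis using True by (intro exI[of _ "l * n div d"]) auto
    next
      case False
      have "m < (K + 1) * (l - m)" 
        unfolding K using lm dividend_less_div_times[of "l - m" m] by (simp add: add.commute)
      then have "m * n \<le> ((K + 1) * (l - m)) * n" by (intro mult_le_mono) auto
      also have "\<dots> = (K + 1) * ((l - m) * n)" by (rule mult.assoc)
      also have "\<dots> < (K + 1) * d" using False by (intro mult_strict_left_mono) auto
      finally show ?thesis using dK by (intro exI[of _ "K + 1"]) (simp add: mult.commute)
    qed
  qed
  then obtain k where "m * n < d * k" "d * k \<le> l * n" by blast
  then show "d \<in> {d. \<exists>i\<in>{m * n<..l * n}. d dvd i}"
    by (intro CollectI bexI[of _ "d * k"]) auto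
qed

text \<open>
  For k \<le> m/(l - m) one has l k \<le> m (k + 1) \<le> m k', that is l/k' \<le> m/k.
\<close>
lemma interval_quotients_separated:
  fixes l m n k k' :: nat
  assumes lm: "m < l" and k: "k \<le> m div (l - m)" "0 < k" "k < k'"
  shows "l * n div k' \<le> m * n div k"
proof -
  define x where "x = l * n div k'"
  have "k * (l - m) \<le> m" using k(1) lm by (subst (asm) less_eq_div_iff_mult_less_eq) auto
  then have "k * l \<le> m + k * m" by (simp add: diff_mult_distrib2 algebra_simps)
  also have "\<dots> = m * (k + 1)" by simp
  also have "\<dots> \<le> m * k'" using k by (intro mult_le_mono) auto
  finally have kl: "k * l \<le> m * k'" .
  have "x * k' \<le> l * n" unfolding x_def by simp
  have "l * (x * k) = x * (k * l)" by simp
  also have "\<dots> \<le> x * (m * k')" by (intro mult_le_mono kl order_refl)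
  also have "\<dots> = m * (x * k')" by simp
  also have "\<dots> \<le> m * (l * n)" by (intro mult_le_mono \<open>x * k' \<le> l * n\<close> order_refl)
  also have "\<dots> = l * (m * n)" by simp
  finally have "x * k \<le> m * n" using lm by (subst (asm) mult_le_cancel1) auto
  then show ?thesis using k unfolding x_def by (subst less_eq_div_iff_mult_less_eq) auto
qed

lemma ln_Lcm_interval:
  fixes l m n K :: nat
  assumes lm: "m < l" and K: "K = m div (l - m)"
  shows "ln (real (Lcm {m * n<..l * n})) 
           = (\<Sum>k=1..K. psi (l * n div k) - psi (m * n div k)) + psi (l * n div (K + 1))"
proof -
  have diff: "(\<Sum>d\<in>{a<..b}. mangoldt d) = psi b - psi a" if "a \<le> b" for a b
  proof -
    have "{..b} = {..a} \<union> {a<..b}" using that by auto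
    then show ?thesis unfolding psi_def by (simp only:) (subst sum.union_disjoint, auto)
  qed
  have sep: "l * n div k' \<le> m * n div k" if "k \<in> {1..K}" "k < k'" for k k'
    using interval_quotients_separated[OF lm, of k k' n] that K by auto
  have "ln (real (Lcm {m * n<..l * n})) = (\<Sum>d\<in>(\<Union>k\<in>{1..K}. {m * n div k<..l * n div k}) \<union> {1..l * n div (K + 1)}. mangoldt d)"
    by (subst ln_Lcm_eq_sum_mangoldt) (auto simp: divisors_of_interval[OF lm K])
  also have "\<dots> = (\<Sum>d\<in>(\<Union>k\<in>{1..K}. {m * n div k<..l * n div k}). mangoldt d) + (\<Sum>d\<in>{1..l * n div (K + 1)}. mangoldt d)"
  proof (rule sum.union_disjoint)
    have "d \<notin> {1..l * n div (K + 1)}" if "k \<in> {1..K}" "d \<in> {m * n div k<..l * n div k}" for d k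
      using sep[of k "K + 1"] that by auto
    then show "(\<Union>k\<in>{1..K}. {m * n div k<..l * n div k}) \<inter> {1..l * n div (K + 1)} = {}" by blast
  qed auto
  also have "(\<Sum>d\<in>(\<Union>k\<in>{1..K}. {m * n div k<..l * n div k}). mangoldt d) = (\<Sum>k=1..K. \<Sum>d\<in>{m * n div k<..l * n div k}. mangoldt d :: real)"
  proof (rule sum.UNION_disjoint)
    have *: "{m * n div k<..l * n div k} \<inter> {m * n div k'<..l * n div k'} = {}" if "k \<in> {1..K}" "k < k'" for k k'
      using sep[OF that] by auto
    show "\<forall>k\<in>{1..K}. \<forall>k'\<in>{1..K}. k \<noteq> k' \<longrightarrow> {m * n div k<..l * n div k} \<inter> {m * n div k'<..l * n div k'} = {}"
    proof (intro ballI impI)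
      fix k k' assume k: "k \<in> {1..K}" "k' \<in> {1..K}" "k \<noteq> k'"
      then consider "k < k'" | "k' < k" by linarith
      then show "{m * n div k<..l * n div k} \<inter> {m * n div k'<..l * n div k'} = {}"
        using *[of k k'] *[of k' k] k by cases blast+
    qed
  qed auto
  also have "\<dots> = (\<Sum>k=1..K. psi (l * n div k) - psi (m * n div k))"
    using lm by (intro sum.cong diff refl div_le_mono mult_le_mono) auto
  also have "(\<Sum>d\<in>{1..l * n div (K + 1)}. mangoldt d) = psi (l * n div (K + 1))"
    unfolding psi_def by (rule sum.mono_neutral_left) (auto simp: Suc_le_eq)
  finally show ?thesis .
qed

lemma psi_quotient_tendsto:
  assumes k: "k > 0"
  shows "(\<lambda>n. psi (c * n div k) / n) \<longlonglongrightarrow> c / k"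
proof (cases "c = 0")
  case True
  then show ?thesis by (simp add: psi_def)
next
  case False
  have bounds: "real (c * n div k) \<le> c * n / k" "c * n / k - 1 \<le> real (c * n div k)" for n
    using floor_divide_of_nat_eq[of "c * n" k, where ?'a = real] 
          of_int_floor_le[of "real (c * n) / real k"] real_of_int_floor_gt_diff_one[of "real (c * n) / real k"] by simp_all
  have top: "filterlim (\<lambda>n. c * n div k) at_top sequentially"
  proof (rule filterlim_at_top_mono)
    show "filterlim (\<lambda>n. n div k) at_top sequentially"
    proof (subst filterlim_at_top, intro allI)
      fix Z show "\<forall>\<^sub>F n in sequentially. Z \<le> n div k"
        using eventually_ge_at_top[of "Z * k"] by eventually_elim (use k in \<open>simp add: less_eq_div_iff_mult_less_eq\<close>)
    qed
    show "\<forall>\<^sub>F n in sequentially. n div k \<le> c * n div k"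
      using False by (intro always_eventually allI div_le_mono) auto
  qed
  have 1: "(\<lambda>n. psi (c * n div k) / real (c * n div k)) \<longlonglongrightarrow> 1"
    by (rule filterlim_compose[OF prime_number_theorem_psi top])
  have 2: "(\<lambda>n. real (c * n div k) / n) \<longlonglongrightarrow> c / k"
  proof (rule real_tendsto_sandwich)
    show "\<forall>\<^sub>F n in sequentially. c / k - 1 / n \<le> real (c * n div k) / n"
      using eventually_gt_at_top[of 0]
    proof eventually_elim
      case (elim n)
      have "c / k - 1 / n = (c * n / k - 1) / n" using elim by (simp add: field_simps)
      also have "\<dots> \<le> real (c * n div k) / n" by (intro divide_right_mono bounds) auto
      finally show ?case .
    qed
    show "\<forall>\<^sub>F n in sequentially. real (c * n div k) / n \<le> c / k"
      using eventually_gt_at_top[of 0]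
    proof eventually_elim
      case (elim n)
      have "real (c * n div k) / n \<le> (c * n / k) / n" by (intro divide_right_mono bounds) auto
      also have "\<dots> = c / k" using elim by simp
      finally show ?case .
    qed
    show "(\<lambda>n. c / k - 1 / n) \<longlonglongrightarrow> c / k" by real_asymp
  qed auto
  have eq: "(\<lambda>n. psi (c * n div k) / real (c * n div k) * (real (c * n div k) / n)) = (\<lambda>n. psi (c * n div k) / n)"
    by (auto simp: fun_eq_iff psi_def)
  show ?thesis using tendsto_mult[OF 1 2] unfolding eq by simp
qed

lemma ln_Lcm_interval_tendsto:
  fixes l m K :: nat
  assumes lm: "m < l" and K: "K = m div (l - m)"
  shows "(\<lambda>n. ln (real (Lcm {m * n<..l * n})) / n) 
           \<longlonglongrightarrow> real l / real (K + 1) + real (l - m) * (\<Sum>k=1..K. 1 / real k)"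
proof -
  have "(\<lambda>n. (\<Sum>k=1..K. psi (l * n div k) / n - psi (m * n div k) / n) + psi (l * n div (K + 1)) / n)
          \<longlonglongrightarrow> (\<Sum>k=1..K. l / k - m / k) + l / (K + 1)"
    by (intro tendsto_add tendsto_sum tendsto_diff psi_quotient_tendsto) auto
  also have "(\<lambda>n. (\<Sum>k=1..K. psi (l * n div k) / n - psi (m * n div k) / n) + psi (l * n div (K + 1)) / n)
     = (\<lambda>n. ln (real (Lcm {m * n<..l * n})) / n)"
    by (simp add: ln_Lcm_interval[OF lm K] add_divide_distrib sum_divide_distrib diff_divide_distrib)
  also have "(\<Sum>k=1..K. l / k - m / k) + l / (K + 1) = real l / real (K + 1) + real (l - m) * (\<Sum>k=1..K. 1 / real k)"
    using lm by (simp add: sum_distrib_left diff_divide_distrib of_nat_diff)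
  finally show ?thesis .
qed

text \<open>
  The formula for m < l < 2 m also covers l \<ge> 2 m: there K = 0 and its value is l, except for l = 2 m, where K = 1
  and its value is l/2 + m = l. Moreover \<lfloor>l/(l-m)\<rfloor> = K + 1.
\<close>
lemma lcm_growth_const_eq:
  fixes l m K :: nat
  assumes lm: "m < l" and K: "K = m div (l - m)"
  shows "lcm_growth_const (int l) (int m) = real l / real (K + 1) + real (l - m) * (\<Sum>k=1..K. 1 / real k)"
proof -
  have f1: "\<lfloor>real_of_int (int m) / real_of_int (int l - int m)\<rfloor> = int K"
    using floor_divide_of_nat_eq[of m "l - m", where ?'a = real] lm by (simp add: K of_nat_diff)
  have "l = m + (l - m)" using lm by simp
  then have "l div (l - m) = K + 1"
    unfolding K using lm by (metis div_add_self2 zero_less_diff not_gr_zero Suc_eq_plus1)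
  then have f2: "\<lfloor>real_of_int (int l) / real_of_int (int l - int m)\<rfloor> = int (K + 1)"
    using floor_divide_of_nat_eq[of l "l - m", where ?'a = real] lm by (simp add: of_nat_diff)
  have "(\<Sum>i = 1..int K. 1 / real_of_int i) = (\<Sum>k=1..K. 1 / real k)"
    by (rule sum.reindex_bij_witness[of _ int nat]) auto
  then have B: "real_of_int (int l) / real_of_int \<lfloor>real_of_int (int l) / real_of_int (int l - int m)\<rfloor>
           + real_of_int (int l - int m) * (\<Sum>i = 1..\<lfloor>real_of_int (int m) / real_of_int (int l - int m)\<rfloor>. 1 / real_of_int i)
        = real l / real (K + 1) + real (l - m) * (\<Sum>k=1..K. 1 / real k)"
    unfolding f1 f2 using lm by (simp add: of_nat_diff)
  show ?thesis
  proof (cases "2 * m \<le> l")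
    case True
    have "real l / real (K + 1) + real (l - m) * (\<Sum>k=1..K. 1 / real k) = real l"
    proof (cases "2 * m = l")
      case True
      then have "K = 1" using lm unfolding K by auto
      then show ?thesis using True by auto
    next
      case False
      then have "K = 0" using \<open>2 * m \<le> l\<close> unfolding K by auto
      then show ?thesis by simp
    qed
    then show ?thesis using True by (simp add: lcm_growth_const_def)
  next
    case False
    then show ?thesis using B by (simp add: lcm_growth_const_def)
  qed
qed

theorem corollary1p3:
  fixes l m :: int
  assumes "l > m" and "m \<ge> 0"
  shows "(\<lambda>n::nat. ln (real_of_int (Lcm {i::int. m * int n < i \<and> i \<le> l * int n})))
           \<sim>[at_top] (\<lambda>n. lcm_growth_const l m * real n)"
proof -
  obtain l' m' where lm: "l = int l'" "m = int m'" using assms by (metis nonneg_int_cases order.trans less_imp_le)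
  then have m'l': "m' < l'" using assms by simp
  define B where "B = lcm_growth_const l m"
  define K where "K = m' div (l' - m')"
  have B: "B = real l' / real (K + 1) + real (l' - m') * (\<Sum>k=1..K. 1 / real k)"
    unfolding B_def lm by (rule lcm_growth_const_eq[OF m'l' K_def])
  have "real l' / real (K + 1) > 0" using m'l' by simp
  moreover have "real (l' - m') * (\<Sum>k=1..K. 1 / real k) \<ge> 0" using m'l' by (intro mult_nonneg_nonneg sum_nonneg) auto
  ultimately have Bpos: "B > 0" unfolding B by linarith
  have Lcm: "Lcm {i::int. m * int n < i \<and> i \<le> l * int n} = int (Lcm {m' * n<..l' * n})" for n
  proof -
    have "{i::int. m * int n < i \<and> i \<le> l * int n} = int ` {m' * n<..l' * n}"
    proof (intro equalityI subsetI)
      fix i assume i: "i \<in> {i::int. m * int n < i \<and> i \<le> l * int n}"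
      have "0 \<le> m * int n" using assms by simp
      then obtain j where "i = int j" using i by (metis mem_Collect_eq nonneg_int_cases order.trans less_imp_le)
      then show "i \<in> int ` {m' * n<..l' * n}" using i by (auto simp: lm simp flip: of_nat_mult)
    qed (auto simp: lm simp flip: of_nat_mult)
    then show ?thesis by (simp add: Lcm_int_eq)
  qed
  have lim: "(\<lambda>n. ln (real (Lcm {m' * n<..l' * n})) / n) \<longlonglongrightarrow> B"
    unfolding B by (rule ln_Lcm_interval_tendsto[OF m'l' K_def])
  have "(\<lambda>n. ln (real (Lcm {m' * n<..l' * n})) / n / B) \<longlonglongrightarrow> B / B"
    by (intro tendsto_divide lim tendsto_const) (use Bpos in auto)
  then have "(\<lambda>n. ln (real (Lcm {m' * n<..l' * n})) / (B * n)) \<longlonglongrightarrow> 1"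
    using Bpos by (simp add: mult.commute)
  then have "(\<lambda>n. ln (real (Lcm {m' * n<..l' * n}))) \<sim>[at_top] (\<lambda>n. B * real n)"
    by (rule asymp_equivI')
  then show ?thesis by (simp add: Lcm B_def)
qed

end
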